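(* Let $\pi_0$ be a probability density on $\mathbb{R}^d$ with finite mean. Let $\{\mathbf{c}_t\}_{t\ge 0}$ be the stochastic localization tilt process of $\pi_0$, with induced random measures $\{\pi_t\}_{t\ge0}$, and let $\{\mathbf{v}_\tau\}_{\tau\in[0,1)}$ be the Polchinski process of $\pi_0$, with fluctuation measures $\pi_\tau^{\mathbf{v}_\tau}$ (all defined in the context). Then, under the time change $t=\frac{\tau}{1-\tau}$, the processes satisfy $$\mathbf{c}_t=\frac{1}{1-\tau}\mathbf{v}_\tau$$ (as an equality in law of processes), and under this reparameterization the induced measures $\pi_t$ and $\pi_\tau^{\mathbf{v}_\tau}$ are identical.
   Context: Probability measures on $\mathbb{R}^d$ are identified with their Lebesgue densities. Stochastic localization: with $\{\mathbf{W}_t\}_{t\ge0}$ a Wiener process in $\mathbb{R}^d$, $$\mathbf{c}_0=\mathbf{0},\qquad d\mathbf{c}_t=\mathbf{m}_t\,dt+d\mathbf{W}_t,\qquad \mathbf{m}_t=\mathbb{E}_{\mathbf{x}\sim\pi_t}[\mathbf{x}],\qquad \pi_t(\mathbf{x})\propto\exp\left(\langle\mathbf{c}_t,\mathbf{x}\rangle-\tfrac t2\|\mathbf{x}\|_2^2\right)\pi_0(\mathbf{x}).$$ Fluctuation measures: for $\mathbf{v}\in\mathbb{R}^d$ and $\tau\in[0,1)$, $$\pi_\tau^{\mathbf{v}}(\mathbf{x})\propto\exp\left(\tfrac{1}{1-\tau}\langle\mathbf{v},\mathbf{x}\rangle-\tfrac{\tau}{2(1-\tau)}\|\mathbf{x}\|_2^2\right)\pi_0(\mathbf{x}).$$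 Polchinski process: with $\{\mathbf{W}_\tau\}$ a Wiener process (indexed by $\tau$), $$\mathbf{v}_0=\mathbf{0},\qquad d\mathbf{v}_\tau=-\tfrac{1}{1-\tau}(\mathbf{v}_\tau-\mathbf{m}_\tau)\,d\tau+d\mathbf{W}_\tau,\qquad \mathbf{m}_\tau=\mathbb{E}_{\mathbf{x}\sim\pi_\tau^{\mathbf{v}_\tau}}[\mathbf{x}].$$ Standing assumption: these SDEs are well posed (a solution exists and is unique in law). *)

theory Defs
  imports "HOL-Probability.Probability"
begin

text \<open>
  The probability measure whose Lebesgue density is proportional to \<open>g \<ge> 0\<close>.  If the normalising
  constant is infinite, no such measure exists and the definition yields the null measure
  (a finite number divided by \<open>\<infinity>\<close> is \<open>0\<close> in \<^typ>\<open>ennreal\<close>).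
\<close>

definition normalized :: "('v::euclidean_space \<Rightarrow> real) \<Rightarrow> 'v measure" where
  "normalized g =
     density lborel (\<lambda>x. ennreal (g x) / (\<integral>\<^sup>+y. ennreal (g y) \<partial>lborel))"

definition mean :: "'v::euclidean_space measure \<Rightarrow> 'v" where
  "mean \<mu> = (LINT x|\<mu>. x)"

definition tilt_measure :: "('v::euclidean_space \<Rightarrow> real) \<Rightarrow> real \<Rightarrow> 'v \<Rightarrow> 'v measure" where
  "tilt_measure \<pi>0 t c = normalized (\<lambda>x. exp (c \<bullet> x - t / 2 * (norm x)\<^sup>2) * \<pi>0 x)"

definition fluctuation_measure :: "('v::euclidean_space \<Rightarrow> real) \<Rightarrow> real \<Rightarrow> 'v \<Rightarrow> 'v measure" where
  "fluctuation_measure \<pi>0 \<tau> v =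
     normalized (\<lambda>x. exp (1 / (1 - \<tau>) * (v \<bullet> x) - \<tau> / (2 * (1 - \<tau>)) * (norm x)\<^sup>2) * \<pi>0 x)"

text \<open>The drifts of the two equations as functions of time and state.\<close>

definition localization_drift :: "('v::euclidean_space \<Rightarrow> real) \<Rightarrow> real \<Rightarrow> 'v \<Rightarrow> 'v" where
  "localization_drift \<pi>0 t c = mean (tilt_measure \<pi>0 t c)"

definition polchinski_drift :: "('v::euclidean_space \<Rightarrow> real) \<Rightarrow> real \<Rightarrow> 'v \<Rightarrow> 'v" where
  "polchinski_drift \<pi>0 \<tau> v =
     - (1 / (1 - \<tau>)) *\<^sub>R (v - mean (fluctuation_measure \<pi>0 \<tau> v))"

text \<open>
  A Wiener process with respect to a filtration \<open>F\<close>, with times in \<open>I\<close> (below \<open>{0..}\<close> or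
  \<open>{0..<1}\<close>).  The product of one-dimensional normal densities is the density of
  \<open>N(0, (t - s) Id)\<close>; note that \<^const>\<open>normal_density\<close> takes the standard deviation.
\<close>

definition wiener_process ::
  "real set \<Rightarrow> 'a measure \<Rightarrow> (real \<Rightarrow> 'a measure) \<Rightarrow> (real \<Rightarrow> 'a \<Rightarrow> 'v::euclidean_space) \<Rightarrow> bool"
where
  "wiener_process I M F W \<longleftrightarrow>
     prob_space M \<and>
     (\<forall>t\<in>I. subalgebra M (F t)) \<and>
     (\<forall>s\<in>I. \<forall>t\<in>I. s \<le> t \<longrightarrow> subalgebra (F t) (F s)) \<and>
     (\<forall>t\<in>I. W t \<in> borel_measurable (F t)) \<and>
     (AE \<omega> in M. W 0 \<omega> = 0) \<and>
     (AE \<omega> in M. continuous_on I (\<lambda>t. W t \<omega>)) \<and>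
     (\<forall>s\<in>I. \<forall>t\<in>I. s < t \<longrightarrow>
        distributed M lborel (\<lambda>\<omega>. W t \<omega> - W s \<omega>)
          (\<lambda>x. ennreal (\<Prod>b\<in>Basis. normal_density 0 (sqrt (t - s)) (x \<bullet> b))) \<and>
        prob_space.indep_set M (sets (F s))
          (sets (vimage_algebra (space M) (\<lambda>\<omega>. W t \<omega> - W s \<omega>) borel)))"

text \<open>
  \<open>X\<close> is a (weak) solution of \<open>dX\<^sub>t = b(t, X\<^sub>t) dt + dW\<^sub>t\<close>, \<open>X\<^sub>0 = 0\<close>, driven by \<open>W\<close>.  As the
  diffusion coefficient is the identity, the integral form involves no stochastic integral.
\<close>

definition sde_solution ::
  "real set \<Rightarrow> (real \<Rightarrow> 'v \<Rightarrow> 'v) \<Rightarrow> 'a measure \<Rightarrow> (real \<Rightarrow> 'a measure) \<Rightarrow>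
   (real \<Rightarrow> 'a \<Rightarrow> 'v::euclidean_space) \<Rightarrow> (real \<Rightarrow> 'a \<Rightarrow> 'v) \<Rightarrow> bool"
where
  "sde_solution I b M F W X \<longleftrightarrow>
     wiener_process I M F W \<and>
     (\<forall>t\<in>I. X t \<in> borel_measurable (F t)) \<and>
     (AE \<omega> in M. continuous_on I (\<lambda>t. X t \<omega>)) \<and>
     (AE \<omega> in M. X 0 \<omega> = 0) \<and>
     (AE \<omega> in M. \<forall>t\<in>I.
        set_integrable lborel {0..t} (\<lambda>s. b s (X s \<omega>)) \<and>
        X t \<omega> = X 0 \<omega> + (LINT s:{0..t}|lborel. b s (X s \<omega>)) + W t \<omega>)"

text \<open>
  The law of a process with time set \<open>I\<close> and state space \<open>S\<close>, on the product sigma-algebra; two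
  such laws agree iff all finite-dimensional distributions agree.
\<close>

definition process_law :: "real set \<Rightarrow> 'a measure \<Rightarrow> 's measure \<Rightarrow> (real \<Rightarrow> 'a \<Rightarrow> 's) \<Rightarrow> (real \<Rightarrow> 's) measure"
where
  "process_law I M S X = distr M (\<Pi>\<^sub>M t\<in>I. S) (\<lambda>\<omega>. \<lambda>t\<in>I. X t \<omega>)"

text \<open>
  Existence of a solution and uniqueness in law.  HOL cannot quantify over the type of the sample
  space, so it is fixed to functions \<^typ>\<open>real \<Rightarrow> 'v \<times> 'v\<close>.  This loses nothing: a solution
  \<open>(X, W)\<close> on any probability space can be transported, keeping its law, to the set of its
  joint sample paths \<open>t \<mapsto> (X\<^sub>t, W\<^sub>t)\<close> (outside a null set), with the sigma-algebra and the
  filtration generated by the coordinates.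
\<close>

definition well_posed :: "real set \<Rightarrow> (real \<Rightarrow> 'v \<Rightarrow> 'v::euclidean_space) \<Rightarrow> bool" where
  "well_posed I b \<longleftrightarrow>
     (\<exists>(M :: (real \<Rightarrow> 'v \<times> 'v) measure) F W X. sde_solution I b M F W X) \<and>
     (\<forall>(M :: (real \<Rightarrow> 'v \<times> 'v) measure) F W X (N :: (real \<Rightarrow> 'v \<times> 'v) measure) G B Y.
        sde_solution I b M F W X \<longrightarrow> sde_solution I b N G B Y \<longrightarrow>
        process_law I M borel X = process_law I N borel Y)"

end

theory Submission
  imports Defs "HOL-Real_Asymp.Real_Asymp"
begin

text \<open>
  If \<open>c\<close> solves the localization equation driven by \<open>W\<close>, then \<open>v\<^sub>\<tau> = (1 - \<tau>) c\<^sub>t\<close> with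
  \<open>t = \<tau> / (1 - \<tau>)\<close> solves the Polchinski equation driven by
  \<open>B\<^sub>\<tau> = \<integral>\<^sub>0\<^sup>\<tau> (1 - s) dZ\<^sub>s = (1 - \<tau>) Z\<^sub>\<tau> + \<integral>\<^sub>0\<^sup>\<tau> Z\<^sub>s ds\<close>, where \<open>Z\<^sub>s\<close> is \<open>W\<close> at time
  \<open>s / (1 - s)\<close>; integration by parts removes the stochastic integral.  The increments of \<open>B\<close> are
  almost sure limits of sums of independent Gaussian increments of \<open>Z\<close>, whose variances
  converge because the clock \<open>s / (1 - s)\<close> has derivative \<open>1 / (1 - s)\<^sup>2\<close>; hence \<open>B\<close> is a Wiener
  process.  Uniqueness in law then identifies this solution with the given one, once both have
  been transported to the path space for which uniqueness is assumed.
\<close>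

section \<open>Isotropic Gaussian measures\<close>

text \<open>With \<open>v = (1 - s) c\<close> and \<open>dt = ds / (1 - s)^2\<close>, the product
  rule gives \<open>dv = - c ds + (1 / (1 - s)) m ds + (1 - s) dZ\<close>. As
  \<open>c = v / (1 - s)\<close>, the first two terms are \<open>- (v - m) / (1 - s) ds\<close>, the
  Polchinski drift. A Wiener process relative to the time-changed filtration needs increments that
  are Gaussian and also independent of the whole past. Both are recorded in one identity,
  \<open>P(A \<inter> {X \<in> B}) = P(A) \<gamma>(B)\<close> for all past events \<open>A\<close>.
  It survives sums of successive increments and almost sure limits, so no characteristic functions
  are needed. The equation itself is verified path by path. Along a path the drift is merely
  integrable in time, which calls for substitution and Fubini in Lebesgue form instead of calculus
  with continuous integrands. Finally, the induced measures are measurable functions of the state,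
  so the equality of their laws follows from that of the states.\<close>

definition isotropic_gaussian :: "real \<Rightarrow> 'v::euclidean_space measure" where
  "isotropic_gaussian \<sigma> =
     distr (density lborel (\<lambda>x. ennreal (\<Prod>b\<in>Basis. normal_density 0 1 (x \<bullet> b)))) borel ((*\<^sub>R) \<sigma>)"

lemma prob_space_normal_product:
  assumes "0 < \<sigma>"
  shows "prob_space (density lborel
    (\<lambda>x::'v::euclidean_space. ennreal (\<Prod>b\<in>Basis. normal_density 0 \<sigma> (x \<bullet> b))))"
proof
  have "(\<integral>\<^sup>+x. ennreal (\<Prod>b\<in>Basis. normal_density 0 \<sigma> ((x :: 'v) \<bullet> b)) \<partial>lborel) =
      (\<integral>\<^sup>+x. (\<Prod>b\<in>Basis. ennreal (normal_density 0 \<sigma> ((x :: 'v) \<bullet> b))) \<partial>lborel)"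
    by (simp add: prod_ennreal)
  also have "\<dots> = (\<Prod>b\<in>(Basis :: 'v set). \<integral>\<^sup>+x. ennreal (normal_density 0 \<sigma> x) \<partial>lborel)"
    by (intro nn_integral_lborel_prod) auto
  also have "\<dots> = 1"
  proof -
    have "(\<integral>\<^sup>+x. ennreal (normal_density 0 \<sigma> x) \<partial>lborel) = 1"
      using prob_space.emeasure_space_1[OF prob_space_normal_density[OF assms, of 0]]
      by (simp add: emeasure_density)
    then show ?thesis by simp
  qed
  finally show "emeasure (density lborel (\<lambda>x::'v. ennreal (\<Prod>b\<in>Basis. normal_density 0 \<sigma> (x \<bullet> b))))
     (space (density lborel (\<lambda>x::'v. ennreal (\<Prod>b\<in>Basis. normal_density 0 \<sigma> (x \<bullet> b))))) = 1"
    by (simp add: emeasure_density)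
qed

lemma prob_space_isotropic_gaussian: "prob_space (isotropic_gaussian \<sigma>)"
  unfolding isotropic_gaussian_def
  by (intro prob_space.prob_space_distr prob_space_normal_product) auto

lemma sets_isotropic_gaussian [simp, measurable_cong]: "sets (isotropic_gaussian \<sigma>) = sets borel"
  by (simp add: isotropic_gaussian_def)

lemma space_isotropic_gaussian [simp]: "space (isotropic_gaussian \<sigma>) = UNIV"
  by (simp add: isotropic_gaussian_def)

text \<open>Moves the standard deviation from the measure into the integrand, so that a limit in the
  variance becomes a limit of integrands under one fixed measure.\<close>

lemma nn_integral_isotropic_gaussian_scale:
  fixes f :: "'v::euclidean_space \<Rightarrow> ennreal"
  assumes [measurable]: "f \<in> borel_measurable borel"
  shows "(\<integral>\<^sup>+z. f (a *\<^sub>R z) \<partial>isotropic_gaussian \<sigma>) = (\<integral>\<^sup>+z. f z \<partial>isotropic_gaussian (a * \<sigma>))"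
  by (simp add: isotropic_gaussian_def nn_integral_distr)

text \<open>Defining the law as a scaled standard normal, not by a density, gives a meaning to
  standard deviation 0. That case occurs for empty sums and for increments of length 0.\<close>

lemma isotropic_gaussian_0: "isotropic_gaussian 0 = return borel (0 :: 'v::euclidean_space)"
proof (rule measure_eqI)
  let ?\<gamma> = "density lborel (\<lambda>x::'v. ennreal (\<Prod>b\<in>Basis. normal_density 0 1 (x \<bullet> b)))"
  fix A :: "'v set" assume A: "A \<in> sets (isotropic_gaussian 0)"
  interpret prob_space ?\<gamma>
    by (rule prob_space_normal_product) simp
  show "emeasure (isotropic_gaussian 0) A = emeasure (return borel 0) A"
  proof -
    have "(*\<^sub>R) 0 -` A = (if 0 \<in> A then UNIV else {} :: 'v set)"
      by auto
    then show ?thesis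
      using A emeasure_space_1 by (simp add: isotropic_gaussian_def emeasure_distr)
  qed
qed simp

lemma isotropic_gaussian_eq_density:
  assumes "0 < \<sigma>"
  shows "isotropic_gaussian \<sigma> =
    density lborel (\<lambda>x::'v::euclidean_space. ennreal (\<Prod>b\<in>Basis. normal_density 0 \<sigma> (x \<bullet> b)))"
    (is "_ = density lborel ?p")
proof (rule measure_eqI)
  let ?q = "\<lambda>x::'v. ennreal (\<Prod>b\<in>Basis. normal_density 0 1 (x \<bullet> b))"
  \<comment> \<open>The Jacobian of the dilation, one factor \<open>\<sigma>\<close> per coordinate,
    cancels the factor \<open>1 / \<sigma>\<close> in each coordinate density.\<close>
  have scale: "ennreal (\<sigma> ^ DIM('v)) * ?p (\<sigma> *\<^sub>R x) = ?q x" for x :: 'v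
  proof -
    have "\<sigma> * normal_density 0 \<sigma> (\<sigma> * y) = normal_density 0 1 y" for y
      using assms by (simp add: normal_density_def real_sqrt_mult field_simps power2_eq_square)
    then have "\<sigma> ^ DIM('v) * (\<Prod>b\<in>Basis. normal_density 0 \<sigma> ((\<sigma> *\<^sub>R x) \<bullet> b)) =
        (\<Prod>b\<in>Basis. normal_density 0 1 (x \<bullet> b))"
      by (simp flip: prod_constant prod.distrib)
    then show ?thesis
      using assms by (simp flip: ennreal_mult' add: prod_nonneg)
  qed
  fix A :: "'v set" assume "A \<in> sets (isotropic_gaussian \<sigma>)"
  then have [measurable]: "A \<in> sets borel" by simp
  have [measurable]: "(*\<^sub>R) \<sigma> -` A \<in> sets borel"
    by (rule measurable_sets_borel[OF _ \<open>A \<in> sets borel\<close>]) auto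
  have "emeasure (density lborel ?p) A = (\<integral>\<^sup>+x. ?p x * indicator A x \<partial>lborel)"
    by (simp add: emeasure_density)
  also have "\<dots> = (\<integral>\<^sup>+x. \<bar>\<sigma>\<bar> ^ DIM('v) * (?p (0 + \<sigma> *\<^sub>R x) * indicator A (0 + \<sigma> *\<^sub>R x)) \<partial>lborel)"
    using assms
    by (subst lborel_affine[of \<sigma> 0]) (auto simp: nn_integral_density nn_integral_distr)
  also have "\<dots> = (\<integral>\<^sup>+x. ?q x * indicator ((*\<^sub>R) \<sigma> -` A) x \<partial>lborel)"
    using assms by (auto intro!: nn_integral_cong simp: scale[simplified] indicator_def simp flip: mult.assoc)
  also have "\<dots> = emeasure (isotropic_gaussian \<sigma>) A"
    by (simp add: isotropic_gaussian_def emeasure_distr emeasure_density)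
  finally show "emeasure (isotropic_gaussian \<sigma>) A = emeasure (density lborel ?p) A" ..
qed simp

text \<open>The convolution of the two densities factors over the coordinates, which reduces it to
  the one-dimensional convolution formula. A vanishing standard deviation has no density and is
  treated apart, as integration against a point mass.\<close>

lemma nn_integral_isotropic_gaussian_add:
  fixes f :: "'v::euclidean_space \<Rightarrow> ennreal"
  assumes [measurable]: "f \<in> borel_measurable borel" and "0 \<le> \<sigma>" "0 \<le> \<tau>"
  shows "(\<integral>\<^sup>+x. \<integral>\<^sup>+y. f (x + y) \<partial>isotropic_gaussian \<tau> \<partial>isotropic_gaussian \<sigma>) =
         (\<integral>\<^sup>+z. f z \<partial>isotropic_gaussian (sqrt (\<sigma>\<^sup>2 + \<tau>\<^sup>2)))"
proof (cases "\<sigma> = 0 \<or> \<tau> = 0")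
  case True
  interpret \<tau>: prob_space "isotropic_gaussian \<tau> :: 'v measure"
    by (rule prob_space_isotropic_gaussian)
  have [measurable]: "(\<lambda>x. \<integral>\<^sup>+y. f (x + y) \<partial>isotropic_gaussian \<tau>) \<in> borel_measurable borel"
    by measurable
  from True show ?thesis
    using assms by (auto simp: isotropic_gaussian_0 nn_integral_return)
next
  case False
  then have pos [arith]: "0 < \<sigma>" "0 < \<tau>"
    using assms by auto
  then have pos': "0 < sqrt (\<sigma>\<^sup>2 + \<tau>\<^sup>2)"
    by (simp add: add_pos_pos)
  define p where "p s x = ennreal (\<Prod>b\<in>Basis. normal_density 0 s (x \<bullet> b))" for s and x :: 'v
  have [measurable]: "p s \<in> borel_measurable borel" for s
    unfolding p_def by measurable
  have conv: "(\<integral>\<^sup>+x. p \<tau> (z - x) * p \<sigma> x \<partial>lborel) = p (sqrt (\<sigma>\<^sup>2 + \<tau>\<^sup>2)) z" for z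
  proof -
    have "(\<integral>\<^sup>+x. p \<tau> (z - x) * p \<sigma> x \<partial>lborel) =
        (\<integral>\<^sup>+x. (\<Prod>b\<in>Basis. ennreal (normal_density 0 \<tau> (z \<bullet> b - x \<bullet> b) * normal_density 0 \<sigma> (x \<bullet> b))) \<partial>lborel)"
      unfolding p_def
      by (auto intro!: nn_integral_cong
          simp: prod_ennreal prod.distrib inner_diff_left prod_nonneg simp flip: ennreal_mult)
    also have "\<dots> = (\<Prod>b\<in>Basis. \<integral>\<^sup>+y. ennreal (normal_density 0 \<tau> (z \<bullet> b - y) * normal_density 0 \<sigma> y) \<partial>lborel)"
      by (intro nn_integral_lborel_prod) auto
    also have "\<dots> = p (sqrt (\<sigma>\<^sup>2 + \<tau>\<^sup>2)) z"
      using fun_cong[OF conv_normal_density_zero_mean[of \<tau> \<sigma>]]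
      by (simp add: p_def prod_ennreal add.commute)
    finally show ?thesis .
  qed
  have shift: "(\<integral>\<^sup>+y. p \<tau> y * f (x + y) \<partial>lborel) = (\<integral>\<^sup>+z. p \<tau> (z - x) * f z \<partial>lborel)" for x
    by (subst (2) lborel_distr_plus[of x, symmetric]) (simp add: nn_integral_distr)
  have "(\<integral>\<^sup>+x. \<integral>\<^sup>+y. f (x + y) \<partial>isotropic_gaussian \<tau> \<partial>isotropic_gaussian \<sigma>) =
      (\<integral>\<^sup>+x. p \<sigma> x * (\<integral>\<^sup>+y. p \<tau> y * f (x + y) \<partial>lborel) \<partial>lborel)"
    using pos by (simp add: isotropic_gaussian_eq_density nn_integral_density flip: p_def)
  also have "\<dots> = (\<integral>\<^sup>+x. \<integral>\<^sup>+z. (p \<tau> (z - x) * p \<sigma> x) * f z \<partial>lborel \<partial>lborel)"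
    unfolding shift by (subst nn_integral_cmult[symmetric]) (auto simp: mult_ac)
  also have "\<dots> = (\<integral>\<^sup>+z. \<integral>\<^sup>+x. (p \<tau> (z - x) * p \<sigma> x) * f z \<partial>lborel \<partial>lborel)"
    by (rule lborel_pair.Fubini') measurable
  also have "\<dots> = (\<integral>\<^sup>+z. p (sqrt (\<sigma>\<^sup>2 + \<tau>\<^sup>2)) z * f z \<partial>lborel)"
    by (subst nn_integral_multc) (auto simp: conv)
  also have "\<dots> = (\<integral>\<^sup>+z. f z \<partial>isotropic_gaussian (sqrt (\<sigma>\<^sup>2 + \<tau>\<^sup>2)))"
    using pos' by (simp add: isotropic_gaussian_eq_density nn_integral_density flip: p_def)
  finally show ?thesis .
qed

section \<open>Gaussian variables independent of a sigma-algebra\<close>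

text \<open>Law and independence in a single identity: \<open>A = space M\<close> gives the law of
  \<open>X\<close>, and general \<open>A\<close> its independence of \<open>F\<close>. In this form
  it says that a joint law is a product measure, and for fixed \<open>A\<close> it is an equality of
  two finite measures in \<open>B\<close>.\<close>

definition indep_gaussian ::
  "'a measure \<Rightarrow> 'a measure \<Rightarrow> ('a \<Rightarrow> 'v::euclidean_space) \<Rightarrow> real \<Rightarrow> bool" where
  "indep_gaussian M F X \<sigma> \<longleftrightarrow>
     subalgebra M F \<and> X \<in> borel_measurable M \<and>
     (\<forall>A\<in>sets F. \<forall>B\<in>sets borel.
        emeasure M (A \<inter> X -` B) = emeasure M A * emeasure (isotropic_gaussian \<sigma>) B)"

lemma indep_gaussianD:
  assumes "indep_gaussian M F X \<sigma>"
  shows "subalgebra M F" "X \<in> borel_measurable M"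
    and "\<And>A B. A \<in> sets F \<Longrightarrow> B \<in> sets borel \<Longrightarrow>
      emeasure M (A \<inter> X -` B) = emeasure M A * emeasure (isotropic_gaussian \<sigma>) B"
  using assms by (auto simp: indep_gaussian_def)

text \<open>The freezing principle: what is known to \<open>F\<close> is held fixed while
  \<open>X\<close> is integrated out. It holds because the joint law of the sample point, seen
  through \<open>F\<close>, and of \<open>X\<close> is a product measure.\<close>

lemma nn_integral_indep_gaussian:
  assumes "prob_space M" and X: "indep_gaussian M F X \<sigma>"
    and \<phi> [measurable]: "\<phi> \<in> borel_measurable (F \<Otimes>\<^sub>M borel)"
  shows "(\<integral>\<^sup>+\<omega>. \<phi> (\<omega>, X \<omega>) \<partial>M) = (\<integral>\<^sup>+\<omega>. \<integral>\<^sup>+z. \<phi> (\<omega>, z) \<partial>isotropic_gaussian \<sigma> \<partial>M)"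
proof -
  interpret M: prob_space M by fact
  note sub = indep_gaussianD(1)[OF X]
  note [measurable] = indep_gaussianD(2)[OF X]
  have [measurable]: "(\<lambda>\<omega>. \<omega>) \<in> M \<rightarrow>\<^sub>M F"
    using sub by (auto simp: subalgebra_def measurable_def)
  let ?R = "restr_to_subalg M F" and ?\<gamma> = "isotropic_gaussian \<sigma> :: 'b measure"
  have [measurable_cong]: "sets ?R = sets F"
    by (rule sets_restr_to_subalg[OF sub])
  interpret R: prob_space ?R
    by (rule prob_space_restr_to_subalg[OF sub]) fact
  interpret \<gamma>: prob_space ?\<gamma>
    by (rule prob_space_isotropic_gaussian)
  have eq: "?R \<Otimes>\<^sub>M ?\<gamma> = distr M (F \<Otimes>\<^sub>M borel) (\<lambda>\<omega>. (\<omega>, X \<omega>))"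
  proof (rule pair_measure_eqI)
    show "sets (?R \<Otimes>\<^sub>M ?\<gamma>) = sets (distr M (F \<Otimes>\<^sub>M borel) (\<lambda>\<omega>. (\<omega>, X \<omega>)))"
      by (simp cong: sets_pair_measure_cong add: sets_restr_to_subalg[OF sub])
  next
    fix A B assume A: "A \<in> sets ?R" and "B \<in> sets ?\<gamma>"
    then have [measurable]: "A \<in> sets F" and B [measurable]: "B \<in> sets borel"
      by (auto simp: sets_restr_to_subalg[OF sub])
    have "A \<subseteq> space M"
      using sets.sets_into_space[OF A] by (simp add: space_restr_to_subalg)
    then have "(\<lambda>\<omega>. (\<omega>, X \<omega>)) -` (A \<times> B) \<inter> space M = A \<inter> X -` B"
      by auto
    then show "emeasure ?R A * emeasure ?\<gamma> B =
        emeasure (distr M (F \<Otimes>\<^sub>M borel) (\<lambda>\<omega>. (\<omega>, X \<omega>))) (A \<times> B)"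
      by (simp add: emeasure_distr indep_gaussianD(3)[OF X] emeasure_restr_to_subalg[OF sub])
  qed (unfold_locales)
  have "(\<integral>\<^sup>+\<omega>. \<phi> (\<omega>, X \<omega>) \<partial>M) = (\<integral>\<^sup>+p. \<phi> p \<partial>(?R \<Otimes>\<^sub>M ?\<gamma>))"
    unfolding eq by (simp add: nn_integral_distr)
  also have "\<dots> = (\<integral>\<^sup>+\<omega>. \<integral>\<^sup>+z. \<phi> (\<omega>, z) \<partial>?\<gamma> \<partial>?R)"
    by (rule \<gamma>.nn_integral_fst[symmetric]) measurable
  also have "\<dots> = (\<integral>\<^sup>+\<omega>. \<integral>\<^sup>+z. \<phi> (\<omega>, z) \<partial>?\<gamma> \<partial>M)"
    by (intro nn_integral_subalgebra2[OF sub] \<gamma>.borel_measurable_nn_integral) measurable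
  finally show ?thesis .
qed

lemma indep_gaussian_scaleR:
  assumes X: "indep_gaussian M F X \<sigma>"
  shows "indep_gaussian M F (\<lambda>\<omega>. a *\<^sub>R X \<omega>) (a * \<sigma>)"
  unfolding indep_gaussian_def
proof (intro conjI ballI)
  note [measurable] = indep_gaussianD(2)[OF X]
  show "(\<lambda>\<omega>. a *\<^sub>R X \<omega>) \<in> borel_measurable M" by measurable
  fix A and B :: "'b set" assume A: "A \<in> sets F" and B [measurable]: "B \<in> sets borel"
  have B': "(*\<^sub>R) a -` B \<in> sets borel"
    by (rule measurable_sets_borel[OF _ B]) auto
  have "emeasure (isotropic_gaussian \<sigma>) ((*\<^sub>R) a -` B) = emeasure (isotropic_gaussian (a * \<sigma>)) B"
    using B' by (simp add: isotropic_gaussian_def emeasure_distr vimage_def)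
  moreover have "(\<lambda>\<omega>. a *\<^sub>R X \<omega>) -` B = X -` ((*\<^sub>R) a -` B)"
    by auto
  ultimately show "emeasure M (A \<inter> (\<lambda>\<omega>. a *\<^sub>R X \<omega>) -` B) =
      emeasure M A * emeasure (isotropic_gaussian (a * \<sigma>)) B"
    using indep_gaussianD(3)[OF X A B'] by simp
qed (rule indep_gaussianD(1)[OF X])

lemma indep_gaussian_const_0:
  assumes "subalgebra M F"
  shows "indep_gaussian M F (\<lambda>_. 0 :: 'v::euclidean_space) 0"
  unfolding indep_gaussian_def
proof (intro conjI ballI)
  fix A and B :: "'v set" assume "A \<in> sets F" "B \<in> sets borel"
  then show "emeasure M (A \<inter> (\<lambda>_. 0) -` B) = emeasure M A * emeasure (isotropic_gaussian 0) B"
    by (cases "0 \<in> B") (auto simp: isotropic_gaussian_0)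
qed (use assms in auto)

text \<open>Freezing is applied twice. \<open>Y\<close> is independent of \<open>F'\<close>, which
  knows both \<open>A\<close> and \<open>X\<close>, so \<open>Y\<close> is integrated out first.
  What remains is a function of \<open>X\<close> alone, and \<open>X\<close> is independent of
  \<open>F\<close>. The two Gaussian integrals then merge into one.\<close>

lemma indep_gaussian_add:
  assumes "prob_space M"
    and X: "indep_gaussian M F X \<sigma>" and X' [measurable]: "X \<in> borel_measurable F'"
    and Y: "indep_gaussian M F' Y \<tau>"
    and sub: "subalgebra F' F" and nonneg: "0 \<le> \<sigma>" "0 \<le> \<tau>"
  shows "indep_gaussian M F (\<lambda>\<omega>. X \<omega> + Y \<omega>) (sqrt (\<sigma>\<^sup>2 + \<tau>\<^sup>2))"
  unfolding indep_gaussian_def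
proof (intro conjI ballI)
  note [measurable] = indep_gaussianD(2)[OF X] indep_gaussianD(2)[OF Y]
  show "(\<lambda>\<omega>. X \<omega> + Y \<omega>) \<in> borel_measurable M" by measurable
  fix A and B :: "'b set" assume A [measurable]: "A \<in> sets F" and B [measurable]: "B \<in> sets borel"
  have A' [measurable]: "A \<in> sets F'"
    using sub by (auto simp: subalgebra_def)
  have A'' [measurable]: "A \<in> sets M"
    using indep_gaussianD(1)[OF X] by (auto simp: subalgebra_def)
  interpret \<tau>: prob_space "isotropic_gaussian \<tau> :: 'b measure"
    by (rule prob_space_isotropic_gaussian)
  let ?\<gamma> = "isotropic_gaussian (sqrt (\<sigma>\<^sup>2 + \<tau>\<^sup>2)) :: 'b measure"
  have [measurable]: "(\<lambda>x. \<integral>\<^sup>+y. indicator B (x + y) \<partial>isotropic_gaussian \<tau>) \<in> borel_measurable borel"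
    by measurable
  have "emeasure M (A \<inter> (\<lambda>\<omega>. X \<omega> + Y \<omega>) -` B) = (\<integral>\<^sup>+\<omega>. indicator A \<omega> * indicator B (X \<omega> + Y \<omega>) \<partial>M)"
  proof -
    have "A \<inter> (\<lambda>\<omega>. X \<omega> + Y \<omega>) -` B = A \<inter> ((\<lambda>\<omega>. X \<omega> + Y \<omega>) -` B \<inter> space M)"
      using sets.sets_into_space[OF A''] by auto
    also have "\<dots> \<in> sets M" by measurable
    finally have "emeasure M (A \<inter> (\<lambda>\<omega>. X \<omega> + Y \<omega>) -` B) =
        (\<integral>\<^sup>+\<omega>. indicator (A \<inter> (\<lambda>\<omega>. X \<omega> + Y \<omega>) -` B) \<omega> \<partial>M)"
      by (rule nn_integral_indicator[symmetric])
    then show ?thesis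
      by (auto simp: indicator_def intro!: nn_integral_cong)
  qed
  also have "\<dots> = (\<integral>\<^sup>+\<omega>. \<integral>\<^sup>+y. indicator A \<omega> * indicator B (X \<omega> + y) \<partial>isotropic_gaussian \<tau> \<partial>M)"
    by (rule nn_integral_indep_gaussian[OF \<open>prob_space M\<close> Y,
          of "\<lambda>(\<omega>, y). indicator A \<omega> * indicator B (X \<omega> + y)", simplified]) measurable
  also have "\<dots> = (\<integral>\<^sup>+\<omega>. indicator A \<omega> * (\<integral>\<^sup>+y. indicator B (X \<omega> + y) \<partial>isotropic_gaussian \<tau>) \<partial>M)"
    by (simp add: nn_integral_cmult)
  also have "\<dots> = (\<integral>\<^sup>+\<omega>. \<integral>\<^sup>+x. indicator A \<omega> *
      (\<integral>\<^sup>+y. indicator B (x + y) \<partial>isotropic_gaussian \<tau>) \<partial>isotropic_gaussian \<sigma> \<partial>M)"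
    by (rule nn_integral_indep_gaussian[OF \<open>prob_space M\<close> X,
          of "\<lambda>(\<omega>, x). indicator A \<omega> * (\<integral>\<^sup>+y. indicator B (x + y) \<partial>isotropic_gaussian \<tau>)",
          simplified]) measurable
  also have "\<dots> = (\<integral>\<^sup>+\<omega>. indicator A \<omega> * emeasure ?\<gamma> B \<partial>M)"
    by (subst nn_integral_cmult, measurable)
       (simp add: nn_integral_isotropic_gaussian_add nonneg)
  also have "\<dots> = emeasure M A * emeasure ?\<gamma> B"
    by (simp add: nn_integral_multc)
  finally show "emeasure M (A \<inter> (\<lambda>\<omega>. X \<omega> + Y \<omega>) -` B) = emeasure M A * emeasure ?\<gamma> B" .
qed (rule indep_gaussianD(1)[OF X])

text \<open>For fixed \<open>A\<close> the identity is tested on continuous functions with values in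
  [0, 1]. There both sides converge by dominated convergence: one along the almost sure limit, the
  other along the standard deviations after scaling. Such functions determine a finite
  measure.\<close>

lemma indep_gaussian_lim:
  fixes X :: "'a \<Rightarrow> 'v::euclidean_space"
  assumes "prob_space M" and Xn: "\<And>n. indep_gaussian M F (Xn n) (s n)"
    and s: "s \<longlonglongrightarrow> \<sigma>" and X [measurable]: "X \<in> borel_measurable M"
    and lim: "AE \<omega> in M. (\<lambda>n. Xn n \<omega>) \<longlonglongrightarrow> X \<omega>"
  shows "indep_gaussian M F X \<sigma>"
  unfolding indep_gaussian_def
proof (intro conjI ballI)
  show sub: "subalgebra M F"
    using Xn[of 0] by (simp add: indep_gaussian_def)
  show "X \<in> borel_measurable M" by fact
  interpret M: prob_space M by fact
  note [measurable] = indep_gaussianD(2)[OF Xn]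
  let ?\<gamma> = "isotropic_gaussian :: real \<Rightarrow> 'v measure"
  interpret \<gamma>1: prob_space "?\<gamma> 1" by (rule prob_space_isotropic_gaussian)
  interpret \<gamma>: prob_space "?\<gamma> \<sigma>" by (rule prob_space_isotropic_gaussian)
  fix A and B :: "'v set" assume A [measurable]: "A \<in> sets F" and B [measurable]: "B \<in> sets borel"
  have A'' [measurable]: "A \<in> sets M"
    using sub by (auto simp: subalgebra_def)
  have test: "(\<integral>\<^sup>+\<omega>. indicator A \<omega> * ennreal (f (X \<omega>)) \<partial>M) =
      emeasure M A * (\<integral>\<^sup>+z. ennreal (f z) \<partial>?\<gamma> \<sigma>)"
    if f: "continuous_on UNIV f" "\<And>x. 0 \<le> f x" "\<And>x. f x \<le> 1" for f
  proof (rule LIMSEQ_unique)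
    have [measurable]: "f \<in> borel_measurable borel"
      using f(1) by (rule borel_measurable_continuous_onI)
    have cont: "(\<lambda>n. f (x n)) \<longlonglongrightarrow> f y" if "x \<longlonglongrightarrow> y" for x y
      using continuous_on_tendsto_compose[OF f(1) that] by simp
    show "(\<lambda>n. \<integral>\<^sup>+\<omega>. indicator A \<omega> * ennreal (f (Xn n \<omega>)) \<partial>M) \<longlonglongrightarrow>
        (\<integral>\<^sup>+\<omega>. indicator A \<omega> * ennreal (f (X \<omega>)) \<partial>M)"
    proof (rule nn_integral_dominated_convergence[where w = "\<lambda>_. 1"])
      show "AE \<omega> in M. (\<lambda>n. indicator A \<omega> * ennreal (f (Xn n \<omega>))) \<longlonglongrightarrow> indicator A \<omega> * ennreal (f (X \<omega>))"
        using lim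
        by eventually_elim (auto intro!: ennreal_tendsto_cmult tendsto_ennrealI cont simp: indicator_def)
    qed (auto simp: indicator_def f M.emeasure_space_1)
    have "(\<integral>\<^sup>+\<omega>. indicator A \<omega> * ennreal (f (Xn n \<omega>)) \<partial>M) =
        emeasure M A * (\<integral>\<^sup>+z. ennreal (f (s n *\<^sub>R z)) \<partial>?\<gamma> 1)" for n
    proof -
      have "(\<integral>\<^sup>+\<omega>. indicator A \<omega> * ennreal (f (Xn n \<omega>)) \<partial>M) =
          (\<integral>\<^sup>+\<omega>. \<integral>\<^sup>+z. indicator A \<omega> * ennreal (f z) \<partial>?\<gamma> (s n) \<partial>M)"
        by (rule nn_integral_indep_gaussian[OF \<open>prob_space M\<close> Xn,
              of "\<lambda>(\<omega>, z). indicator A \<omega> * ennreal (f z)", simplified]) measurable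
      also have "\<dots> = emeasure M A * (\<integral>\<^sup>+z. ennreal (f z) \<partial>?\<gamma> (s n))"
        by (simp add: nn_integral_cmult nn_integral_multc)
      finally show ?thesis
        by (simp add: nn_integral_isotropic_gaussian_scale[of "\<lambda>z. ennreal (f z)"])
    qed
    moreover have "(\<lambda>n. \<integral>\<^sup>+z. ennreal (f (s n *\<^sub>R z)) \<partial>?\<gamma> 1) \<longlonglongrightarrow> (\<integral>\<^sup>+z. ennreal (f (\<sigma> *\<^sub>R z)) \<partial>?\<gamma> 1)"
      by (rule nn_integral_dominated_convergence[where w = "\<lambda>_. 1"])
         (use \<gamma>1.emeasure_space_1 in \<open>auto intro!: AE_I2 tendsto_ennrealI cont tendsto_scaleR s simp: f\<close>)
    ultimately show "(\<lambda>n. \<integral>\<^sup>+\<omega>. indicator A \<omega> * ennreal (f (Xn n \<omega>)) \<partial>M) \<longlonglongrightarrow>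
        emeasure M A * (\<integral>\<^sup>+z. ennreal (f z) \<partial>?\<gamma> \<sigma>)"
      by (auto intro!: ennreal_tendsto_cmult simp: M.emeasure_finite less_top[symmetric]
          nn_integral_isotropic_gaussian_scale[of "\<lambda>z. ennreal (f z)"])
  qed
  \<comment> \<open>Both sides are finite measures in \<open>B\<close>, and the closed sets form an
    intersection-stable generator of the Borel sets, so it suffices to compare them on closed
    sets.\<close>
  have eq: "distr (density M (indicator A)) borel X = scale_measure (emeasure M A) (?\<gamma> \<sigma>)" (is "?\<mu> = ?\<nu>")
  proof (rule measure_eqI_generator_eq[where E = "Collect closed" and \<Omega> = UNIV and A = "\<lambda>_. UNIV"])
    show "Int_stable (Collect closed :: 'v set set)"
      by (auto simp: Int_stable_def)
    show "sets ?\<mu> = sigma_sets UNIV (Collect closed)" "sets ?\<nu> = sigma_sets UNIV (Collect closed)"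
      by (simp_all add: borel_eq_closed)
    fix C :: "'v set" assume "C \<in> Collect closed"
    then have C: "closed C" and [measurable]: "C \<in> sets borel" by auto
    show "emeasure ?\<mu> C = emeasure ?\<nu> C"
    proof (cases "C = {}")
      case False
      \<comment> \<open>Continuous functions that tend to the indicator of \<open>C\<close>: they
        are 1 on \<open>C\<close>, and outside the closed set \<open>C\<close> the distance is
        positive. The empty set is excluded because \<open>infdist x {}\<close> is 0 by
        convention.\<close>
      define f where "f k x = 1 / (1 + real k * infdist x C)" for k x
      have den: "1 \<le> 1 + real k * infdist x C" for k x
        using infdist_nonneg[of x C] by simp
      have f: "continuous_on UNIV (f k)" "0 \<le> f k x" "f k x \<le> 1" for k x
        using den[of k] unfolding f_def
        by (auto intro!: continuous_intros simp: divide_le_eq add_nonneg_eq_0_iff infdist_nonneg)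
      have [measurable]: "f k \<in> borel_measurable borel" for k
        using f(1) by (rule borel_measurable_continuous_onI)
      have f_lim: "(\<lambda>k. f k x) \<longlonglongrightarrow> indicator C x" for x
      proof (cases "x \<in> C")
        case True
        then show ?thesis by (simp add: f_def)
      next
        case outside: False
        then have "0 < infdist x C"
          using C False by (intro infdist_pos_not_in_closed)
        then have "(\<lambda>k. f k x) \<longlonglongrightarrow> 0"
          unfolding f_def by real_asymp
        then show ?thesis using outside by simp
      qed
      have conv: "(\<lambda>k. \<integral>\<^sup>+x. ennreal (f k x) \<partial>\<rho>) \<longlonglongrightarrow> emeasure \<rho> C"
        if [measurable_cong]: "sets \<rho> = sets borel" and fin: "emeasure \<rho> UNIV < \<infinity>" for \<rho> :: "'v measure"
      proof -
        have "space \<rho> = UNIV"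
          using sets_eq_imp_space_eq[OF that(1)] by simp
        then have "(\<lambda>k. \<integral>\<^sup>+x. ennreal (f k x) \<partial>\<rho>) \<longlonglongrightarrow> (\<integral>\<^sup>+x. ennreal (indicator C x) \<partial>\<rho>)"
          using fin
          by (intro nn_integral_dominated_convergence[where w = "\<lambda>_. 1"])
             (auto intro!: AE_I2 tendsto_ennrealI f_lim simp: f)
        then show ?thesis
          by (simp add: ennreal_indicator that(1))
      qed
      have fin\<mu>: "emeasure ?\<mu> UNIV < \<infinity>"
        by (simp add: emeasure_distr emeasure_density nn_integral_indicator M.emeasure_finite less_top[symmetric])
      have fin\<nu>: "emeasure ?\<nu> UNIV < \<infinity>"
        using \<gamma>.emeasure_space_1 by (simp add: M.emeasure_finite less_top[symmetric])
      have "(\<integral>\<^sup>+x. ennreal (f k x) \<partial>?\<mu>) = (\<integral>\<^sup>+x. ennreal (f k x) \<partial>?\<nu>)" for k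
        using test[OF f, of k]
        by (simp add: nn_integral_distr nn_integral_density nn_integral_scale_measure)
      then show ?thesis
        using conv[OF _ fin\<mu>] conv[OF _ fin\<nu>] by (auto intro: LIMSEQ_unique)
    qed simp
  qed (auto simp: emeasure_distr emeasure_density M.emeasure_finite)
  have "A \<inter> X -` B = A \<inter> (X -` B \<inter> space M)"
    using sets.sets_into_space[OF A''] by auto
  then have "emeasure M (A \<inter> X -` B) = emeasure ?\<mu> B"
    by (simp add: emeasure_distr emeasure_density nn_integral_set_ennreal flip: indicator_inter_arith)
  then show "emeasure M (A \<inter> X -` B) = emeasure M A * emeasure (?\<gamma> \<sigma>) B"
    by (simp add: eq)
qed

lemma wiener_process_indep_increment:
  fixes W :: "real \<Rightarrow> 'a \<Rightarrow> 'v::euclidean_space"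
  assumes W: "wiener_process I M F W" and st: "s \<in> I" "t \<in> I" "s \<le> t"
  shows "indep_gaussian M (F s) (\<lambda>\<omega>. W t \<omega> - W s \<omega>) (sqrt (t - s))"
proof (cases "s = t")
  case True
  then show ?thesis
    using W st indep_gaussian_const_0[of M "F s"] by (simp add: wiener_process_def)
next
  case False
  then have "s < t" using st by simp
  let ?D = "\<lambda>\<omega>. W t \<omega> - W s \<omega>"
  interpret prob_space M
    using W by (simp add: wiener_process_def)
  have sub: "subalgebra M (F s)"
    and D: "distributed M lborel ?D (\<lambda>x. ennreal (\<Prod>b\<in>Basis. normal_density 0 (sqrt (t - s)) (x \<bullet> b)))"
    and indep: "indep_set (sets (F s)) (sets (vimage_algebra (space M) ?D borel))"
    using W st \<open>s < t\<close> by (auto simp: wiener_process_def)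
  have [measurable]: "?D \<in> borel_measurable M"
    using distributed_measurable[OF D] by simp
  show ?thesis
    unfolding indep_gaussian_def
  proof (intro conjI ballI)
    fix A and B :: "'v set" assume A: "A \<in> sets (F s)" and B [measurable]: "B \<in> sets borel"
    then have "A \<in> sets M"
      using sub by (auto simp: subalgebra_def)
    then have "A \<inter> ?D -` B = A \<inter> (?D -` B \<inter> space M)"
      using sets.sets_into_space by blast
    moreover have "prob (A \<inter> (?D -` B \<inter> space M)) = prob A * prob (?D -` B \<inter> space M)"
      using A B by (intro indep_setD[OF indep]) (auto intro: in_vimage_algebra)
    moreover have "emeasure M (?D -` B \<inter> space M) = emeasure (isotropic_gaussian (sqrt (t - s))) B"
      using distributed_distr_eq_density[OF D] \<open>s < t\<close>
      by (subst isotropic_gaussian_eq_density) (simp_all add: emeasure_distr flip: distributed_distr_eq_density[OF D])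
    ultimately show "emeasure M (A \<inter> ?D -` B) = emeasure M A * emeasure (isotropic_gaussian (sqrt (t - s))) B"
      by (simp add: emeasure_eq_measure ennreal_mult)
  qed (use sub in auto)
qed

text \<open>With the next lemma this leads back from \<open>indep_gaussian\<close> to the clauses of
  \<open>wiener_process\<close>. Here the event \<open>A\<close> is the whole space.\<close>

lemma indep_gaussian_imp_distributed:
  assumes "prob_space M" and X: "indep_gaussian M F X \<sigma>" and "0 < \<sigma>"
  shows "distributed M lborel X (\<lambda>x. ennreal (\<Prod>b\<in>Basis. normal_density 0 \<sigma> (x \<bullet> b)))"
proof -
  interpret prob_space M by fact
  note [measurable] = indep_gaussianD(2)[OF X]
  have sp: "space M \<in> sets F"
    using indep_gaussianD(1)[OF X] by (metis sets.top subalgebra_def)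
  have "distr M lborel X = isotropic_gaussian \<sigma>"
  proof (rule measure_eqI)
    fix B assume "B \<in> sets (distr M lborel X)"
    then have [measurable]: "B \<in> sets borel" by simp
    show "emeasure (distr M lborel X) B = emeasure (isotropic_gaussian \<sigma>) B"
      using indep_gaussianD(3)[OF X sp, of B] emeasure_space_1
      by (simp add: emeasure_distr Int_commute)
  qed simp
  then show ?thesis
    using \<open>0 < \<sigma>\<close> by (simp add: distributed_def isotropic_gaussian_eq_density)
qed

lemma indep_gaussian_imp_indep_set:
  assumes "prob_space M" and X: "indep_gaussian M F X \<sigma>"
  shows "prob_space.indep_set M (sets F) (sets (vimage_algebra (space M) X borel))"
proof -
  interpret prob_space M by fact
  note [measurable] = indep_gaussianD(2)[OF X]
  have sub: "space F = space M" "sets F \<subseteq> events"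
    using indep_gaussianD(1)[OF X] by (auto simp: subalgebra_def)
  have sp: "space M \<in> sets F"
    using sub by (metis sets.top)
  show ?thesis
    unfolding indep_sets2_eq
  proof (intro conjI ballI sub)
    show "sets (vimage_algebra (space M) X borel) \<subseteq> events"
      using measurable_sets[OF indep_gaussianD(2)[OF X]] by (auto simp: sets_vimage_algebra2)
    fix A C assume A: "A \<in> sets F" and "C \<in> sets (vimage_algebra (space M) X borel)"
    then obtain B where B [measurable]: "B \<in> sets borel" and C: "C = X -` B \<inter> space M"
      by (auto simp: sets_vimage_algebra2)
    have "A \<inter> C = A \<inter> X -` B" "C = space M \<inter> X -` B"
      using sets.sets_into_space[OF A] sub C by auto
    then have "emeasure M (A \<inter> C) = emeasure M A * emeasure M C"
      using indep_gaussianD(3)[OF X A B] indep_gaussianD(3)[OF X sp B] emeasure_space_1 by simp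
    then show "prob (A \<inter> C) = prob A * prob C"
      by (simp add: emeasure_eq_measure flip: ennreal_mult)
  qed
qed

section \<open>Substitution, iterated integrals and Riemann sums\<close>

text \<open>Substitution for an integrand that is only integrable and has values in a Banach space.
  It is reduced to an identity of measures: \<open>g\<close> pushes the measure with density
  \<open>g'\<close> on \<open>{a..b}\<close> forward to Lebesgue measure on
  \<open>{g a..g b}\<close>. Integrals of vector-valued functions then follow from the image-measure
  formula.\<close>

lemma set_integral_substitution:
  fixes f :: "real \<Rightarrow> 'b::{banach, second_countable_topology}" and g g' :: "real \<Rightarrow> real"
  assumes f: "set_integrable lborel {g a..g b} f"
    and g_borel [measurable]: "g \<in> borel_measurable borel" "g' \<in> borel_measurable borel"
    and deriv: "\<And>x. x \<in> {a..b} \<Longrightarrow> (g has_real_derivative g' x) (at x)"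
    and cont: "continuous_on {a..b} g'"
    and nonneg: "\<And>x. x \<in> {a..b} \<Longrightarrow> 0 \<le> g' x"
    and ab: "a \<le> b"
  shows "set_integrable lborel {a..b} (\<lambda>x. g' x *\<^sub>R f (g x))"
    and "(LINT x:{a..b}|lborel. g' x *\<^sub>R f (g x)) = (LINT y:{g a..g b}|lborel. f y)"
proof -
  \<comment> \<open>Extension by zero turns measurability on the interval into measurability on the
    whole line.\<close>
  define h where "h y = indicator {g a..g b} y *\<^sub>R f y" for y
  have h_int: "integrable lborel h"
    using f by (simp add: h_def[abs_def] set_integrable_def)
  then have [measurable]: "h \<in> borel_measurable borel"
    by simp
  let ?i = "indicator {g a..g b} :: real \<Rightarrow> real"
  let ?w = "\<lambda>x. indicator {a..b} x * g' x"
  have w: "0 \<le> ?w x" for x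
    using nonneg by (simp add: indicator_def)
  have g_mono: "g x \<le> g y" if "a \<le> x" "x \<le> y" "y \<le> b" for x y
    using that by (intro deriv_nonneg_imp_mono[OF deriv nonneg]) auto
  have hg: "?w x *\<^sub>R h (g x) = indicator {a..b} x *\<^sub>R (g' x *\<^sub>R f (g x))" for x
    using g_mono by (auto simp: h_def indicator_def)
  have ih: "?i y *\<^sub>R h y = h y" for y
    by (simp add: h_def indicator_def)
  have eq: "density lborel ?i = distr (density lborel ?w) borel g" (is "?L = ?R")
  proof (rule measure_eqI)
    fix E assume "E \<in> sets ?L"
    then have [measurable]: "E \<in> sets borel" by simp
    have "emeasure ?L E = (\<integral>\<^sup>+y. ennreal (indicator E y * indicator {g a..g b} y) \<partial>lborel)"
      by (auto simp: emeasure_density indicator_def intro!: nn_integral_cong)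
    also have "\<dots> = (\<integral>\<^sup>+x. ennreal (indicator E (g x) * g' x * indicator {a..b} x) \<partial>lborel)"
      by (rule nn_integral_substitution[OF _ deriv cont nonneg ab])
         (auto simp: set_borel_measurable_def)
    also have "\<dots> = (\<integral>\<^sup>+x. ennreal (?w x) * indicator (g -` E) x \<partial>lborel)"
      by (auto simp: indicator_def intro!: nn_integral_cong)
    also have "\<dots> = emeasure ?R E"
      using measurable_sets_borel[OF g_borel(1) \<open>E \<in> sets borel\<close>]
      by (simp add: emeasure_distr emeasure_density)
    finally show "emeasure ?L E = emeasure ?R E" .
  qed simp
  have "integrable ?L h"
    using h_int by (simp add: integrable_density ih)
  then have "integrable lborel (\<lambda>x. ?w x *\<^sub>R h (g x))"
    unfolding eq using w by (simp add: integrable_distr_eq integrable_density)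
  then show "set_integrable lborel {a..b} (\<lambda>x. g' x *\<^sub>R f (g x))"
    by (simp only: hg set_integrable_def)
  have "(LINT x:{a..b}|lborel. g' x *\<^sub>R f (g x)) = (LINT x|lborel. ?w x *\<^sub>R h (g x))"
    by (simp only: hg set_lebesgue_integral_def)
  also have "\<dots> = integral\<^sup>L ?R h"
    using w by (simp add: integral_distr integral_density)
  also have "\<dots> = (LINT y:{g a..g b}|lborel. f y)"
    unfolding eq[symmetric] by (subst integral_density) (simp_all add: ih, simp add: set_lebesgue_integral_def h_def)
  finally show "(LINT x:{a..b}|lborel. g' x *\<^sub>R f (g x)) = (LINT y:{g a..g b}|lborel. f y)" .
qed

text \<open>Fubini on the triangle \<open>a \<le> u \<le> s \<le> b\<close>: for fixed
  \<open>u\<close> the variable \<open>s\<close> runs through an interval of length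
  \<open>b - u\<close>. This replaces integration by parts where \<open>f\<close> is only
  integrable.\<close>

lemma set_integral_set_integral_Icc:
  fixes f :: "real \<Rightarrow> 'b::{banach, second_countable_topology}"
  assumes f: "set_integrable lborel {a..b} f"
  shows "(LINT s:{a..b}|lborel. LINT u:{a..s}|lborel. f u) = (LINT u:{a..b}|lborel. (b - u) *\<^sub>R f u)"
proof -
  define h where "h u = indicator {a..b} u *\<^sub>R f u" for u
  have h: "integrable lborel h"
    using f by (simp add: h_def[abs_def] set_integrable_def)
  then have [measurable]: "h \<in> borel_measurable borel" by simp
  define k where "k s u = (if a \<le> s \<and> s \<le> b \<and> u \<le> s then h u else 0)" for s u
  have [measurable]: "(\<lambda>p. k (fst p) (snd p)) \<in> borel_measurable (lborel \<Otimes>\<^sub>M lborel)"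
    unfolding k_def by measurable
  have k_int: "integrable (lborel \<Otimes>\<^sub>M lborel) (\<lambda>(s, u). k s u)"
  proof (rule Bochner_Integration.integrable_bound)
    show "integrable (lborel \<Otimes>\<^sub>M lborel) (\<lambda>(s, u). indicator {a..b} s *\<^sub>R h u)"
    proof (rule lborel_pair.Fubini_integrable)
      have ab_int: "integrable lborel (indicator {a..b} :: real \<Rightarrow> real)"
        by (rule integrable_real_indicator) (auto simp: emeasure_lborel_Icc_eq)
      show "integrable lborel (\<lambda>s. LINT u|lborel. norm (case (s, u) of (s, u) \<Rightarrow> indicator {a..b} s *\<^sub>R h u))"
        using ab_int by simp
    qed (use h in auto)
  qed (auto simp: k_def case_prod_beta indicator_def)
  have "(LINT s:{a..b}|lborel. LINT u:{a..s}|lborel. f u) = (LINT s|lborel. LINT u|lborel. k s u)"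
    by (auto simp: set_lebesgue_integral_def k_def h_def indicator_def if_distrib
        intro!: Bochner_Integration.integral_cong)
  also have "\<dots> = (LINT u|lborel. LINT s|lborel. k s u)"
    by (rule lborel_pair.Fubini_integral[OF k_int, symmetric])
  also have "\<dots> = (LINT u|lborel. LINT s|lborel. indicator {u..b} s *\<^sub>R h u)"
    by (auto simp: k_def h_def indicator_def intro!: Bochner_Integration.integral_cong)
  also have "\<dots> = (LINT u|lborel. (b - u) *\<^sub>R h u)"
  proof (rule Bochner_Integration.integral_cong)
    fix u :: real
    show "(LINT s|lborel. indicator {u..b} s *\<^sub>R h u) = (b - u) *\<^sub>R h u"
      by (cases "u \<le> b") (auto simp: h_def)
  qed simp
  also have "\<dots> = (LINT u:{a..b}|lborel. (b - u) *\<^sub>R f u)"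
    by (simp add: set_lebesgue_integral_def h_def mult.commute)
  finally show ?thesis .
qed

text \<open>Right endpoints are used because summation by parts of the noise produces them. Uniform
  continuity bounds the error on each piece by \<open>e'\<close> times its length.\<close>

lemma right_Riemann_sum_tendsto_integral:
  fixes f :: "real \<Rightarrow> 'b::banach"
  assumes f: "continuous_on {a..b} f" and ab: "a \<le> b"
  shows "(\<lambda>n. \<Sum>i<Suc n. ((b - a) / Suc n) *\<^sub>R f (a + Suc i * ((b - a) / Suc n)))
    \<longlonglongrightarrow> integral {a..b} f"
proof (rule LIMSEQ_I)
  fix e :: real assume "0 < e"
  \<comment> \<open>The summand 1 covers the case \<open>a = b\<close> and makes the final estimate
    strict.\<close>
  define e' where "e' = e / (b - a + 1)"
  have e': "0 < e'" "(b - a) * e' < e"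
    using \<open>0 < e\<close> ab by (auto simp: e'_def field_simps)
  have "uniformly_continuous_on {a..b} f"
    using f by (rule compact_uniformly_continuous) simp
  then obtain d where "0 < d"
    and d: "\<And>x y. x \<in> {a..b} \<Longrightarrow> y \<in> {a..b} \<Longrightarrow> dist y x < d \<Longrightarrow> dist (f y) (f x) < e'"
    using e'(1) unfolding uniformly_continuous_on_def by metis
  have "(\<lambda>n. (b - a) / Suc n) \<longlonglongrightarrow> 0"
    by real_asymp
  then obtain N where N: "\<And>n. N \<le> n \<Longrightarrow> (b - a) / Suc n < d"
    using \<open>0 < d\<close> ab by (fastforce dest: LIMSEQ_D[where r = d])
  show "\<exists>N. \<forall>n\<ge>N. norm ((\<Sum>i<Suc n. ((b - a) / Suc n) *\<^sub>R f (a + Suc i * ((b - a) / Suc n))) - integral {a..b} f) < e"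
  proof (intro exI allI impI)
    fix n assume "N \<le> n"
    define h where "h = (b - a) / Suc n"
    define p where "p i = a + real i * h" for i
    have h: "0 \<le> h" "h < d"
      using ab N[OF \<open>N \<le> n\<close>] by (auto simp: h_def)
    have p_end: "p (Suc n) = b"
      by (simp add: p_def h_def)
    have p_step: "p (Suc i) = p i + h" for i
      by (simp add: p_def algebra_simps)
    have p_mono: "p i \<le> p j" if "i \<le> j" for i j
      using that h by (simp add: p_def mult_right_mono)
    have p_ge: "a \<le> p i" for i
      using h by (simp add: p_def)
    have p_le: "p i \<le> b" if "i \<le> Suc n" for i
      using p_mono[OF that] p_end by simp
    have int: "f integrable_on {p i..p j}" if "j \<le> Suc n" for i j
      using p_ge[of i] p_le[OF that]
      by (intro integrable_continuous_real continuous_on_subset[OF f]) auto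
    have split: "integral {a..p k} f = (\<Sum>i<k. integral {p i..p (Suc i)} f)" if "k \<le> Suc n" for k
      using that
    proof (induction k)
      case 0
      then show ?case by (simp add: p_def)
    next
      case (Suc k)
      have "integral {a..p k} f + integral {p k..p (Suc k)} f = integral {a..p (Suc k)} f"
        using int[OF Suc.prems, of 0] p_ge p_mono[of k "Suc k"]
        by (intro Henstock_Kurzweil_Integration.integral_combine) (auto simp: p_def)
      with Suc show ?case by simp
    qed
    have piece: "norm (h *\<^sub>R f (p (Suc i)) - integral {p i..p (Suc i)} f) \<le> e' * h" if "i < Suc n" for i
    proof -
      have "h *\<^sub>R f (p (Suc i)) - integral {p i..p (Suc i)} f =
          integral {p i..p (Suc i)} (\<lambda>x. f (p (Suc i)) - f x)"
        using int[of "Suc i" i] that h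
        by (subst Henstock_Kurzweil_Integration.integral_diff) (auto simp: p_step)
      also have "norm \<dots> \<le> e' * (p (Suc i) - p i)"
      proof (rule integral_bound)
        show "p i \<le> p (Suc i)" by (rule p_mono) simp
        show "continuous_on {p i..p (Suc i)} (\<lambda>x. f (p (Suc i)) - f x)"
          using p_ge[of i] p_le[of "Suc i"] that
          by (intro continuous_intros continuous_on_subset[OF f]) auto
        fix x assume x: "x \<in> {p i..p (Suc i)}"
        then have "dist (p (Suc i)) x < d"
          using h by (auto simp: p_step dist_real_def)
        then show "norm (f (p (Suc i)) - f x) \<le> e'"
          using d[of x "p (Suc i)"] x p_ge[of i] p_ge[of "Suc i"] p_le[of "Suc i"] that
          by (auto simp: dist_norm)
      qed
      finally show ?thesis by (simp add: p_step)
    qed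
    have "norm ((\<Sum>i<Suc n. h *\<^sub>R f (p (Suc i))) - integral {a..b} f) =
        norm (\<Sum>i<Suc n. h *\<^sub>R f (p (Suc i)) - integral {p i..p (Suc i)} f)"
      using split[of "Suc n"] by (simp add: sum_subtractf p_end)
    also have "\<dots> \<le> (\<Sum>i<Suc n. e' * h)"
      by (intro sum_norm_le piece) simp
    also have "\<dots> = (b - a) * e'"
      by (simp add: h_def)
    also have "\<dots> < e" by (rule e')
    finally show "norm ((\<Sum>i<Suc n. ((b - a) / Suc n) *\<^sub>R f (a + Suc i * ((b - a) / Suc n))) - integral {a..b} f) < e"
      by (simp add: h_def p_def)
  qed
qed

section \<open>Transport to path space\<close>

text \<open>The largest sigma-algebra on the target for which \<open>T\<close> is measurable. A map
  out of it is measurable as soon as its composition with \<open>T\<close> is, so adaptedness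
  transfers although \<open>F t\<close> may contain more than the paths generate.\<close>

definition final_sigma :: "('a \<Rightarrow> 'b) \<Rightarrow> 'a measure \<Rightarrow> 'b measure" where
  "final_sigma T A = sigma UNIV {S. T -` S \<inter> space A \<in> sets A}"

lemma space_final_sigma [simp]: "space (final_sigma T A) = UNIV"
  by (simp add: final_sigma_def space_measure_of_conv)

lemma sets_final_sigma:
  fixes T :: "'a \<Rightarrow> 'b"
  shows "sets (final_sigma T A) = {S. T -` S \<inter> space A \<in> sets A}"
proof -
  have "sigma_algebra UNIV {S. T -` S \<inter> space A \<in> sets A}"
    unfolding sigma_algebra_iff2
  proof (intro conjI ballI allI impI)
    fix S assume "S \<in> {S. T -` S \<inter> space A \<in> sets A}"
    moreover have "T -` (UNIV - S) \<inter> space A = space A - (T -` S \<inter> space A)" by auto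
    ultimately show "UNIV - S \<in> {S. T -` S \<inter> space A \<in> sets A}" by simp
  next
    fix S :: "nat \<Rightarrow> 'b set" assume "range S \<subseteq> {S. T -` S \<inter> space A \<in> sets A}"
    then have "(\<Union>i. T -` S i \<inter> space A) \<in> sets A"
      by (intro sets.countable_UN) auto
    moreover have "T -` (\<Union>i. S i) \<inter> space A = (\<Union>i. T -` S i \<inter> space A)" by auto
    ultimately show "(\<Union>i. S i) \<in> {S. T -` S \<inter> space A \<in> sets A}"
      by (simp only: mem_Collect_eq)
  qed auto
  then show ?thesis
    by (simp add: final_sigma_def sigma_algebra.sigma_sets_eq)
qed

lemma measurable_to_final_sigma: "T \<in> A \<rightarrow>\<^sub>M final_sigma T A"
  by (auto simp: measurable_def sets_final_sigma)

lemma measurable_from_final_sigma: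
  assumes Z: "(\<lambda>\<omega>. Z (T \<omega>)) \<in> A \<rightarrow>\<^sub>M K" and K: "space K = UNIV"
  shows "Z \<in> final_sigma T A \<rightarrow>\<^sub>M K"
proof (rule measurableI)
  fix B assume "B \<in> sets K"
  then have "(\<lambda>\<omega>. Z (T \<omega>)) -` B \<inter> space A \<in> sets A"
    by (rule measurable_sets[OF Z])
  then show "Z -` B \<inter> space (final_sigma T A) \<in> sets (final_sigma T A)"
    by (simp add: sets_final_sigma vimage_def)
qed (simp add: K)

text \<open>
  Path properties such as continuity are not product measurable.  Completing \<open>M\<close> first makes every almost sure property of
  paths measurable in the final sigma-algebra.
\<close>

lemma AE_distr_final_sigma:
  assumes P: "AE \<omega> in M. P (T \<omega>)"
  shows "AE p in distr (completion M) (final_sigma T (completion M)) T. P p"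
proof (subst AE_distr_iff)
  have "Measurable.pred (completion M) (\<lambda>\<omega>. \<not> P (T \<omega>))"
    by (rule sets_completion_AE) (use P in simp)
  then have "Measurable.pred (completion M) (\<lambda>\<omega>. \<not> \<not> P (T \<omega>))"
    by measurable
  then show "{p \<in> space (final_sigma T (completion M)). P p} \<in> sets (final_sigma T (completion M))"
    by (simp add: sets_final_sigma pred_def vimage_def Int_def conj_commute)
qed (use P in \<open>auto intro: AE_completion measurable_to_final_sigma\<close>)

text \<open>The random quantities in \<open>sde_solution\<close> depend on the sample point only
  through the pair of paths \<open>T \<omega>\<close>. Hence the coordinate processes on the image
  space inherit adaptedness and independence by taking preimages, and the almost sure clauses by
  \<open>AE_distr_final_sigma\<close>.\<close>

lemma sde_solution_on_path_space:
  fixes X W :: "real \<Rightarrow> 'a \<Rightarrow> 'v::euclidean_space"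
  assumes sol: "sde_solution I b M F W X"
  obtains N :: "(real \<Rightarrow> 'v \<times> 'v) measure" and G V Y
  where "sde_solution I b N G V Y" and "process_law I N borel Y = process_law I M borel X"
proof
  \<comment> \<open>All real times are recorded, including those outside \<open>I\<close>, where
    \<open>X t\<close> and \<open>W t\<close> need not be measurable; the final sigma-algebra makes
    \<open>T\<close> measurable all the same.\<close>
  define T where "T \<omega> t = (X t \<omega>, W t \<omega>)" for \<omega> t
  define Y where "Y t p = fst (p t)" for t :: real and p :: "real \<Rightarrow> 'v \<times> 'v"
  define V where "V t p = snd (p t)" for t :: real and p :: "real \<Rightarrow> 'v \<times> 'v"
  \<comment> \<open>The filtration is built from \<open>F t\<close> without completion, so that an
    event of \<open>G s\<close> pulls back into \<open>F s\<close>, where independence is known. The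
    completion enters only in \<open>N\<close>.\<close>
  define G where "G t = final_sigma T (F t)" for t
  define N where "N = distr (completion M) (final_sigma T (completion M)) T"
  have YT: "Y t (T \<omega>) = X t \<omega>" and VT: "V t (T \<omega>) = W t \<omega>" for t \<omega>
    by (simp_all add: Y_def V_def T_def)
  have wiener: "wiener_process I M F W"
    and X: "\<And>t. t \<in> I \<Longrightarrow> X t \<in> borel_measurable (F t)"
    using sol by (auto simp: sde_solution_def)
  have sub: "\<And>t. t \<in> I \<Longrightarrow> subalgebra M (F t)"
    and mono: "\<And>s t. s \<in> I \<Longrightarrow> t \<in> I \<Longrightarrow> s \<le> t \<Longrightarrow> subalgebra (F t) (F s)"
    and W: "\<And>t. t \<in> I \<Longrightarrow> W t \<in> borel_measurable (F t)"
    and increment: "\<And>s t. s \<in> I \<Longrightarrow> t \<in> I \<Longrightarrow> s < t \<Longrightarrow>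
      distributed M lborel (\<lambda>\<omega>. W t \<omega> - W s \<omega>)
        (\<lambda>x. ennreal (\<Prod>b\<in>Basis. normal_density 0 (sqrt (t - s)) (x \<bullet> b))) \<and>
      prob_space.indep_set M (sets (F s))
        (sets (vimage_algebra (space M) (\<lambda>\<omega>. W t \<omega> - W s \<omega>) borel))"
    using wiener by (auto simp: wiener_process_def)
  interpret M: prob_space M
    using wiener by (simp add: wiener_process_def)
  interpret CM: prob_space "completion M"
    by (rule M.prob_space_completion)
  have T: "T \<in> completion M \<rightarrow>\<^sub>M final_sigma T (completion M)"
    by (rule measurable_to_final_sigma)
  interpret N: prob_space N
    unfolding N_def by (rule CM.prob_space_distr[OF T])
  have sets_N: "sets N = {S. T -` S \<inter> space M \<in> sets (completion M)}" and space_N: "space N = UNIV"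
    by (simp_all add: N_def sets_final_sigma)
  have AE_N: "AE p in N. P p" if "AE \<omega> in M. P (T \<omega>)" for P
    unfolding N_def by (rule AE_distr_final_sigma[where P = P, OF that])
  have measurable_N: "Z \<in> borel_measurable N"
    if "(\<lambda>\<omega>. Z (T \<omega>)) \<in> borel_measurable M" for Z :: "_ \<Rightarrow> 'v"
    using that unfolding N_def
    by (auto intro!: measurable_from_final_sigma measurable_completion)
  have X_M: "X t \<in> borel_measurable M" and W_M: "W t \<in> borel_measurable M" if "t \<in> I" for t
    using that X W sub by (auto intro: measurable_from_subalg)
  have distr_N: "distr N K Z = distr M K (\<lambda>\<omega>. Z (T \<omega>))"
    if "Z \<in> N \<rightarrow>\<^sub>M K" "(\<lambda>\<omega>. Z (T \<omega>)) \<in> M \<rightarrow>\<^sub>M K" for Z and K :: "'k measure"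
    using that T unfolding N_def
    by (subst distr_distr) (auto simp: comp_def distr_completion)
  have measure_N: "measure N S = measure M (T -` S \<inter> space M)"
    if "T -` S \<inter> space M \<in> sets M" for S
    using that T unfolding N_def
    by (subst measure_distr) (auto simp: sets_final_sigma measure_completion)
  have "wiener_process I N G V"
    unfolding wiener_process_def
  proof (intro conjI ballI impI)
    fix t assume t: "t \<in> I"
    show "subalgebra N (G t)"
      using sub[OF t] by (auto simp: subalgebra_def G_def space_N sets_N sets_final_sigma)
    show "V t \<in> borel_measurable (G t)"
      unfolding G_def using W[OF t] by (intro measurable_from_final_sigma) (auto simp: VT)
  next
    fix s t assume "s \<in> I" "t \<in> I" "s \<le> t"
    then show "subalgebra (G t) (G s)"
      using mono[of s t] by (auto simp: subalgebra_def G_def sets_final_sigma)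
  next
    show "AE p in N. V 0 p = 0" "AE p in N. continuous_on I (\<lambda>t. V t p)"
      using wiener by (auto intro!: AE_N simp: VT wiener_process_def)
  next
    fix s t assume st: "s \<in> I" "t \<in> I" "s < t"
    let ?D = "\<lambda>p. V t p - V s p"
    have D_M: "(\<lambda>\<omega>. W t \<omega> - W s \<omega>) \<in> borel_measurable M"
      using st W_M by auto
    then have D_N: "?D \<in> borel_measurable N"
      by (intro measurable_N) (simp add: VT)
    have "distr N lborel ?D = distr M lborel (\<lambda>\<omega>. W t \<omega> - W s \<omega>)"
      using D_M D_N by (subst distr_N) (simp_all add: VT)
    then show "distributed N lborel ?D
        (\<lambda>x. ennreal (\<Prod>b\<in>Basis. normal_density 0 (sqrt (t - s)) (x \<bullet> b)))"
      using increment[OF st] D_N by (simp add: distributed_def)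
    have indep: "M.indep_set (sets (F s))
        (sets (vimage_algebra (space M) (\<lambda>\<omega>. W t \<omega> - W s \<omega>) borel))"
      using increment[OF st] by simp
    show "N.indep_set (sets (G s)) (sets (vimage_algebra (space N) ?D borel))"
      unfolding N.indep_sets2_eq
    proof (intro conjI ballI)
      show "sets (G s) \<subseteq> sets N"
        using sub[of s] st by (auto simp: subalgebra_def G_def sets_N sets_final_sigma)
      show "sets (vimage_algebra (space N) ?D borel) \<subseteq> sets N"
        using measurable_sets[OF D_N] by (auto simp: sets_vimage_algebra2)
      fix A C assume "A \<in> sets (G s)" and "C \<in> sets (vimage_algebra (space N) ?D borel)"
      then obtain B where B: "B \<in> sets borel" and C: "C = ?D -` B"
        by (auto simp: sets_vimage_algebra2 space_N)
      have A: "T -` A \<inter> space M \<in> sets (F s)"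
        using \<open>A \<in> sets (G s)\<close> sub[of s] st by (auto simp: subalgebra_def G_def sets_final_sigma)
      have TC: "T -` C \<inter> space M = (\<lambda>\<omega>. W t \<omega> - W s \<omega>) -` B \<inter> space M"
        by (auto simp: C VT)
      have C': "T -` C \<inter> space M \<in> sets (vimage_algebra (space M) (\<lambda>\<omega>. W t \<omega> - W s \<omega>) borel)"
        unfolding TC using B by (rule in_vimage_algebra)
      have ev: "T -` A \<inter> space M \<in> sets M" "T -` C \<inter> space M \<in> sets M"
        using M.indep_setD_ev1[OF indep] M.indep_setD_ev2[OF indep] A C' by auto
      have "T -` (A \<inter> C) \<inter> space M = (T -` A \<inter> space M) \<inter> (T -` C \<inter> space M)"
        by auto
      then show "measure N (A \<inter> C) = measure N A * measure N C"
        using M.indep_setD[OF indep A C'] ev by (simp add: measure_N)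
    qed
  qed (unfold_locales)
  then show "sde_solution I b N G V Y"
    using sol X unfolding sde_solution_def
    by (auto intro!: AE_N measurable_from_final_sigma simp: YT VT G_def)
  have "(\<lambda>p. \<lambda>t\<in>I. Y t p) \<in> N \<rightarrow>\<^sub>M (\<Pi>\<^sub>M t\<in>I. borel)"
    using X_M by (intro measurable_restrict measurable_N) (simp add: YT)
  moreover have "(\<lambda>\<omega>. \<lambda>t\<in>I. X t \<omega>) \<in> M \<rightarrow>\<^sub>M (\<Pi>\<^sub>M t\<in>I. borel)"
    using X_M by (intro measurable_restrict) simp
  ultimately show "process_law I N borel Y = process_law I M borel X"
    unfolding process_law_def by (subst distr_N) (simp_all add: YT)
qed

lemma well_posed_process_law_eq:
  fixes X W :: "real \<Rightarrow> 'a \<Rightarrow> 'v::euclidean_space" and Y V :: "real \<Rightarrow> 'b \<Rightarrow> 'v"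
  assumes "well_posed I b" "sde_solution I b M F W X" "sde_solution I b N G V Y"
  shows "process_law I M borel X = process_law I N borel Y"
proof -
  obtain M' :: "(real \<Rightarrow> 'v \<times> 'v) measure" and F' W' X'
    where 1: "sde_solution I b M' F' W' X'" "process_law I M' borel X' = process_law I M borel X"
    by (rule sde_solution_on_path_space[OF assms(2)])
  obtain N' :: "(real \<Rightarrow> 'v \<times> 'v) measure" and G' V' Y'
    where 2: "sde_solution I b N' G' V' Y'" "process_law I N' borel Y' = process_law I N borel Y"
    by (rule sde_solution_on_path_space[OF assms(3)])
  have "process_law I M' borel X' = process_law I N' borel Y'"
    using assms(1) 1(1) 2(1) unfolding well_posed_def by blast
  then show ?thesis
    using 1(2) 2(2) by simp
qed

section \<open>The time-changed noise\<close>

lemma continuous_on_indefinite_integral_Ico: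
  fixes f :: "real \<Rightarrow> 'b::banach"
  assumes f: "continuous_on {a..<b} f"
  shows "continuous_on {a..<b} (\<lambda>x. integral {a..x} f)"
proof (rule continuous_on_eq_continuous_within[THEN iffD2], rule ballI)
  fix x assume x: "x \<in> {a..<b}"
  then obtain y where y: "x < y" "y < b"
    using dense[of x b] by auto
  have "continuous_on {a..y} (\<lambda>x. integral {a..x} f)"
    using y by (intro indefinite_integral_continuous_1 integrable_continuous_real
        continuous_on_subset[OF f]) auto
  then have "continuous (at x within {a..y}) (\<lambda>x. integral {a..x} f)"
    using x y by (auto simp: continuous_on_eq_continuous_within)
  moreover have "at x within {a..y} = at x within {a..<b}"
    using y by (intro at_within_nhd[of _ "{..<y}"]) auto
  ultimately show "continuous (at x within {a..<b}) (\<lambda>x. integral {a..x} f)"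
    by simp
qed

lemma continuous_on_time_change:
  fixes f :: "real \<Rightarrow> 'b::topological_space"
  assumes "continuous_on {0..} f"
  shows "continuous_on {0..<1} (\<lambda>\<tau>. f (\<tau> / (1 - \<tau>)))"
  by (rule continuous_on_compose2[OF assms]) (auto intro!: continuous_intros)

lemma time_change_mono:
  "0 \<le> s \<Longrightarrow> s \<le> t \<Longrightarrow> t < 1 \<Longrightarrow> s / (1 - s) \<le> t / (1 - t)" for s t :: real
  by (auto simp: divide_le_eq le_divide_eq field_simps)

text \<open>
  The limit is \<open>\<integral>\<^sub>0\<^sup>\<tau> W (s / (1 - s)) ds\<close> on continuous paths.  The filtration is not complete and
  only almost all paths are continuous; the limit of Riemann sums is adapted without exception.
\<close>

definition time_changed_noise :: "(real \<Rightarrow> 'a \<Rightarrow> 'v::euclidean_space) \<Rightarrow> real \<Rightarrow> 'a \<Rightarrow> 'v" where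
  "time_changed_noise W \<tau> \<omega> = (1 - \<tau>) *\<^sub>R W (\<tau> / (1 - \<tau>)) \<omega> +
     lim (\<lambda>n. \<Sum>i<Suc n. (\<tau> / Suc n) *\<^sub>R W ((Suc i * (\<tau> / Suc n)) / (1 - Suc i * (\<tau> / Suc n))) \<omega>)"

lemma time_changed_noise_eq:
  fixes W :: "real \<Rightarrow> 'a \<Rightarrow> 'v::euclidean_space"
  assumes W: "continuous_on {0..} (\<lambda>t. W t \<omega>)" and \<tau>: "0 \<le> \<tau>" "\<tau> < 1"
  shows "time_changed_noise W \<tau> \<omega> =
    (1 - \<tau>) *\<^sub>R W (\<tau> / (1 - \<tau>)) \<omega> + integral {0..\<tau>} (\<lambda>s. W (s / (1 - s)) \<omega>)"
proof -
  have "continuous_on {0..\<tau>} (\<lambda>s. W (s / (1 - s)) \<omega>)"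
    using \<tau> by (intro continuous_on_subset[OF continuous_on_time_change[OF W]]) auto
  from right_Riemann_sum_tendsto_integral[OF this \<tau>(1)] show ?thesis
    by (simp add: time_changed_noise_def limI)
qed

text \<open>Abel summation. With weights taken at left endpoints the remaining sum is a Riemann sum
  with right endpoints.\<close>

lemma sum_by_parts_antitone_weight:
  fixes w :: "nat \<Rightarrow> 'v::real_vector" and p :: "nat \<Rightarrow> real"
  shows "(\<Sum>i<k. (1 - p i) *\<^sub>R (w (Suc i) - w i)) =
    (1 - p k) *\<^sub>R w k - (1 - p 0) *\<^sub>R w 0 + (\<Sum>i<k. (p (Suc i) - p i) *\<^sub>R w (Suc i))"
  by (induction k) (simp_all add: algebra_simps)

text \<open>Induction along the partition: the next increment is independent of
  \<open>F (q j)\<close>, to which the sum so far is adapted, so \<open>indep_gaussian_add\<close>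
  applies and the variances add up. The weights are deterministic.\<close>

lemma indep_gaussian_weighted_increments:
  fixes W :: "real \<Rightarrow> 'a \<Rightarrow> 'v::euclidean_space"
  assumes W: "wiener_process I M F W" and q: "\<And>i. i \<le> k \<Longrightarrow> q i \<in> I" "\<And>i j. i \<le> j \<Longrightarrow> j \<le> k \<Longrightarrow> q i \<le> q j"
    and a: "\<And>i. i < k \<Longrightarrow> 0 \<le> a i"
  shows "indep_gaussian M (F (q 0)) (\<lambda>\<omega>. \<Sum>i<k. a i *\<^sub>R (W (q (Suc i)) \<omega> - W (q i) \<omega>))
      (sqrt (\<Sum>i<k. (a i)\<^sup>2 * (q (Suc i) - q i)))"
    and "(\<lambda>\<omega>. \<Sum>i<k. a i *\<^sub>R (W (q (Suc i)) \<omega> - W (q i) \<omega>)) \<in> borel_measurable (F (q k))"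
proof -
  have prob: "prob_space M"
    and sub: "\<And>t. t \<in> I \<Longrightarrow> subalgebra M (F t)"
    and mono: "\<And>s t. s \<in> I \<Longrightarrow> t \<in> I \<Longrightarrow> s \<le> t \<Longrightarrow> subalgebra (F t) (F s)"
    and adapted: "\<And>t. t \<in> I \<Longrightarrow> W t \<in> borel_measurable (F t)"
    using W by (auto simp: wiener_process_def)
  have meas: "(\<lambda>\<omega>. \<Sum>i<j. a i *\<^sub>R (W (q (Suc i)) \<omega> - W (q i) \<omega>)) \<in> borel_measurable (F (q j))"
    if "j \<le> k" for j
  proof -
    have [measurable]: "W (q i) \<in> borel_measurable (F (q j))" if "i \<le> j" for i
      using that \<open>j \<le> k\<close> q by (intro measurable_from_subalg[OF mono adapted]) auto
    show ?thesis
      by (intro borel_measurable_sum borel_measurable_scaleR borel_measurable_diff) auto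
  qed
  from meas[of k] show "(\<lambda>\<omega>. \<Sum>i<k. a i *\<^sub>R (W (q (Suc i)) \<omega> - W (q i) \<omega>)) \<in> borel_measurable (F (q k))"
    by simp
  have "indep_gaussian M (F (q 0)) (\<lambda>\<omega>. \<Sum>i<j. a i *\<^sub>R (W (q (Suc i)) \<omega> - W (q i) \<omega>))
      (sqrt (\<Sum>i<j. (a i)\<^sup>2 * (q (Suc i) - q i)))" if "j \<le> k" for j
    using that
  proof (induction j)
    case 0
    then show ?case
      using indep_gaussian_const_0[OF sub[of "q 0"]] q by simp
  next
    case (Suc j)
    have le: "q j \<le> q (Suc j)" and I: "q j \<in> I" "q (Suc j) \<in> I" "q 0 \<in> I" "q 0 \<le> q j"
      using q Suc.prems by auto
    have nonneg: "0 \<le> (\<Sum>i<j. (a i)\<^sup>2 * (q (Suc i) - q i))"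
      using q Suc.prems by (intro sum_nonneg mult_nonneg_nonneg) auto
    have "indep_gaussian M (F (q j)) (\<lambda>\<omega>. a j *\<^sub>R (W (q (Suc j)) \<omega> - W (q j) \<omega>))
        (a j * sqrt (q (Suc j) - q j))"
      by (intro indep_gaussian_scaleR wiener_process_indep_increment[OF W] I le)
    from indep_gaussian_add[OF prob Suc.IH meas this mono[OF I(3,1,4)]] show ?case
      using Suc.prems a[of j] nonneg le by (simp add: power_mult_distrib)
  qed
  then show "indep_gaussian M (F (q 0)) (\<lambda>\<omega>. \<Sum>i<k. a i *\<^sub>R (W (q (Suc i)) \<omega> - W (q i) \<omega>))
      (sqrt (\<Sum>i<k. (a i)\<^sup>2 * (q (Suc i) - q i)))"
    by simp
qed

text \<open>Each term can be computed exactly. With \<open>y = 1 - p n i\<close>,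
  \<open>z = 1 - p n (Suc i)\<close> and \<open>h = y - z\<close> it equals
  \<open>h * (1 + h / z)\<close>, and \<open>z\<close> is at least \<open>1 - t\<close>. So it lies
  between \<open>h\<close> and \<open>h * (1 + h / (1 - t))\<close>, and both bounds have sums
  tending to \<open>t - s\<close>.\<close>

lemma time_changed_noise_variance_tendsto:
  fixes s t :: real
  assumes st: "0 \<le> s" "s \<le> t" "t < 1"
  defines "p \<equiv> \<lambda>n i. s + real i * ((t - s) / Suc n)"
  shows "(\<lambda>n. \<Sum>i<Suc n. (1 - p n i)\<^sup>2 * (p n (Suc i) / (1 - p n (Suc i)) - p n i / (1 - p n i)))
    \<longlonglongrightarrow> t - s"
proof -
  let ?h = "\<lambda>n. (t - s) / Suc n"
  have bounds: "?h n \<le> (1 - p n i)\<^sup>2 * (p n (Suc i) / (1 - p n (Suc i)) - p n i / (1 - p n i))"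
    "(1 - p n i)\<^sup>2 * (p n (Suc i) / (1 - p n (Suc i)) - p n i / (1 - p n i)) \<le> ?h n * (1 + ?h n / (1 - t))"
    if i: "i < Suc n" for n i
  proof -
    have h: "0 \<le> ?h n" using st by simp
    have step: "p n (Suc i) = p n i + ?h n"
      by (simp only: p_def of_nat_Suc distrib_right mult_1_left)
    have "real (Suc i) * ?h n \<le> real (Suc n) * ?h n"
      using i h by (intro mult_right_mono) auto
    then have pt: "p n (Suc i) \<le> t"
      by (simp add: p_def)
    have "y\<^sup>2 * ((1 - z) / z - (1 - y) / y) = (y - z) * (1 + (y - z) / z)" if "0 < y" "0 < z" for y z :: real
      using that by (simp add: field_simps power2_eq_square)
    from this[of "1 - x" "1 - (x + h)" for x h]
    have eq: "(1 - x)\<^sup>2 * ((x + h) / (1 - (x + h)) - x / (1 - x)) = h * (1 + h / (1 - (x + h)))"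
      if "x + h < 1" "0 \<le> h" for x h :: real
      using that by simp
    have eq': "(1 - p n i)\<^sup>2 * (p n (Suc i) / (1 - p n (Suc i)) - p n i / (1 - p n i)) =
        ?h n * (1 + ?h n / (1 - p n (Suc i)))"
      using eq[of "p n i" "?h n"] pt st h by (simp only: step)
    have r: "0 \<le> ?h n / (1 - p n (Suc i))" "?h n / (1 - p n (Suc i)) \<le> ?h n / (1 - t)"
      using pt st h by (auto intro!: divide_left_mono divide_nonneg_nonneg mult_pos_pos)
    show "?h n \<le> (1 - p n i)\<^sup>2 * (p n (Suc i) / (1 - p n (Suc i)) - p n i / (1 - p n i))"
      unfolding eq' using r(1) h mult_left_mono[of 1 "1 + ?h n / (1 - p n (Suc i))" "?h n"] by simp
    show "(1 - p n i)\<^sup>2 * (p n (Suc i) / (1 - p n (Suc i)) - p n i / (1 - p n i)) \<le> ?h n * (1 + ?h n / (1 - t))"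
      unfolding eq' by (intro mult_left_mono add_left_mono r(2) h)
  qed
  show ?thesis
  proof (rule tendsto_sandwich)
    show "\<forall>\<^sub>F n in sequentially. (\<Sum>i<Suc n. ?h n) \<le>
        (\<Sum>i<Suc n. (1 - p n i)\<^sup>2 * (p n (Suc i) / (1 - p n (Suc i)) - p n i / (1 - p n i)))"
      by (intro always_eventually allI sum_mono bounds) simp
    show "\<forall>\<^sub>F n in sequentially.
        (\<Sum>i<Suc n. (1 - p n i)\<^sup>2 * (p n (Suc i) / (1 - p n (Suc i)) - p n i / (1 - p n i))) \<le>
        (\<Sum>i<Suc n. ?h n * (1 + ?h n / (1 - t)))"
      by (intro always_eventually allI sum_mono bounds) simp
    show "(\<lambda>n. \<Sum>i<Suc n. ?h n) \<longlonglongrightarrow> t - s"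
      by simp
    have "?h \<longlonglongrightarrow> 0"
      by real_asymp
    then have "(\<lambda>n. (t - s) * (1 + ?h n / (1 - t))) \<longlonglongrightarrow> (t - s) * (1 + 0 / (1 - t))"
      using st by (intro tendsto_intros) auto
    then have "(\<lambda>n. (t - s) * (1 + ?h n / (1 - t))) \<longlonglongrightarrow> t - s"
      by simp
    moreover have "(\<Sum>i<Suc n. ?h n * (1 + ?h n / (1 - t))) = (t - s) * (1 + ?h n / (1 - t))" for n
      by (simp only: sum_constant card_lessThan) simp
    ultimately show "(\<lambda>n. \<Sum>i<Suc n. ?h n * (1 + ?h n / (1 - t))) \<longlonglongrightarrow> t - s"
      by (simp only:)
  qed
qed

lemma wiener_process_time_changed_noise:
  fixes W :: "real \<Rightarrow> 'a \<Rightarrow> 'v::euclidean_space"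
  assumes W: "wiener_process {0..} M F W"
  shows "wiener_process {0..<1} M (\<lambda>\<tau>. F (\<tau> / (1 - \<tau>))) (time_changed_noise W)"
proof -
  interpret prob_space M
    using W by (simp add: wiener_process_def)
  have sub: "\<And>t. 0 \<le> t \<Longrightarrow> subalgebra M (F t)"
    and mono: "\<And>s t. 0 \<le> s \<Longrightarrow> s \<le> t \<Longrightarrow> subalgebra (F t) (F s)"
    and adapted: "\<And>t. 0 \<le> t \<Longrightarrow> W t \<in> borel_measurable (F t)"
    and W0: "AE \<omega> in M. W 0 \<omega> = 0"
    and cont: "AE \<omega> in M. continuous_on {0..} (\<lambda>t. W t \<omega>)"
    using W by (auto simp: wiener_process_def)
  let ?B = "time_changed_noise W"
  have B_adapted: "?B \<tau> \<in> borel_measurable (F (\<tau> / (1 - \<tau>)))" if \<tau>: "0 \<le> \<tau>" "\<tau> < 1" for \<tau>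
  proof -
    have meas: "W (s / (1 - s)) \<in> borel_measurable (F (\<tau> / (1 - \<tau>)))" if "0 \<le> s" "s \<le> \<tau>" for s
      using that \<tau> by (intro measurable_from_subalg[OF mono adapted] time_change_mono) auto
    \<comment> \<open>No partition point exceeds \<open>\<tau>\<close>, so the Riemann sums use the
      noise only up to time \<open>\<tau> / (1 - \<tau>)\<close> and are adapted.\<close>
    have "real (Suc i) * (\<tau> / Suc n) \<le> \<tau>" if "i < Suc n" for i n
    proof -
      have "real (Suc i) * (\<tau> / Suc n) \<le> real (Suc n) * (\<tau> / Suc n)"
        using that \<tau> by (intro mult_right_mono) auto
      then show ?thesis by simp
    qed
    then show ?thesis
      unfolding time_changed_noise_def[abs_def] using \<tau>
      by (intro borel_measurable_add borel_measurable_scaleR borel_measurable_lim_metric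
          borel_measurable_sum borel_measurable_const meas) auto
  qed
  have increment: "indep_gaussian M (F (s / (1 - s))) (\<lambda>\<omega>. ?B t \<omega> - ?B s \<omega>) (sqrt (t - s))"
    if st: "0 \<le> s" "s \<le> t" "t < 1" for s t
  proof (rule indep_gaussian_lim)
    define p where "p n i = s + real i * ((t - s) / Suc n)" for n i
    let ?q = "\<lambda>n i. p n i / (1 - p n i)"
    have p: "0 \<le> p n i" "s \<le> p n i" "p n i < 1" "p n i \<le> t" if "i \<le> Suc n" for n i
    proof -
      have "real i * ((t - s) / Suc n) \<le> real (Suc n) * ((t - s) / Suc n)"
        using that st by (intro mult_right_mono) auto
      then have "real i * ((t - s) / Suc n) \<le> t - s" by simp
      then show "0 \<le> p n i" "s \<le> p n i" "p n i < 1" "p n i \<le> t"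
        using st by (auto simp: p_def)
    qed
    have p_mono: "p n i \<le> p n j" if "i \<le> j" for n i j
      using that st by (auto simp: p_def intro!: divide_right_mono mult_right_mono)
    have p_ends: "p n 0 = s" "p n (Suc n) = t" for n
      by (simp_all add: p_def)
    let ?X = "\<lambda>n \<omega>. \<Sum>i<Suc n. (1 - p n i) *\<^sub>R (W (?q n (Suc i)) \<omega> - W (?q n i) \<omega>)"
    show "indep_gaussian M (F (s / (1 - s))) (?X n)
        (sqrt (\<Sum>i<Suc n. (1 - p n i)\<^sup>2 * (?q n (Suc i) - ?q n i)))" for n
    proof -
      have "indep_gaussian M (F (?q n 0)) (?X n)
          (sqrt (\<Sum>i<Suc n. (1 - p n i)\<^sup>2 * (?q n (Suc i) - ?q n i)))"
        using p p_mono
        by (intro indep_gaussian_weighted_increments(1)[OF W])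
           (auto simp: less_imp_le intro!: time_change_mono)
      then show ?thesis
        by (simp only: p_ends(1))
    qed
    show "(\<lambda>n. sqrt (\<Sum>i<Suc n. (1 - p n i)\<^sup>2 * (?q n (Suc i) - ?q n i))) \<longlonglongrightarrow> sqrt (t - s)"
      unfolding p_def by (intro tendsto_real_sqrt time_changed_noise_variance_tendsto st)
    show "(\<lambda>\<omega>. ?B t \<omega> - ?B s \<omega>) \<in> borel_measurable M"
      using st by (intro borel_measurable_diff measurable_from_subalg[OF sub B_adapted]) auto
    show "AE \<omega> in M. (\<lambda>n. ?X n \<omega>) \<longlonglongrightarrow> ?B t \<omega> - ?B s \<omega>"
      using cont
    proof eventually_elim
      case (elim \<omega>)
      let ?w = "\<lambda>r. W (r / (1 - r)) \<omega>"
      have w: "continuous_on {0..t} ?w"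
        using st by (intro continuous_on_subset[OF continuous_on_time_change[OF elim]]) auto
      \<comment> \<open>On the partition of \<open>{s..t}\<close> that is uniform in the new time,
        Abel summation splits the weighted increments into boundary terms independent of
        \<open>n\<close> and a Riemann sum of a continuous path.\<close>
      have "?X n \<omega> = (1 - t) *\<^sub>R ?w t - (1 - s) *\<^sub>R ?w s +
          (\<Sum>i<Suc n. ((t - s) / Suc n) *\<^sub>R ?w (s + Suc i * ((t - s) / Suc n)))" for n
      proof -
        have "p n (Suc i) - p n i = (t - s) / Suc n" for i
          by (simp only: p_def of_nat_Suc distrib_right mult_1_left)
        then show ?thesis
          using sum_by_parts_antitone_weight[of "p n" "\<lambda>i. ?w (p n i)" "Suc n"]
          by (simp only: p_ends) (simp only: p_def)
      qed
      moreover have "(\<lambda>n. \<Sum>i<Suc n. ((t - s) / Suc n) *\<^sub>R ?w (s + Suc i * ((t - s) / Suc n)))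
          \<longlonglongrightarrow> integral {s..t} ?w"
        using st by (intro right_Riemann_sum_tendsto_integral continuous_on_subset[OF w]) auto
      ultimately have lim: "(\<lambda>n. ?X n \<omega>) \<longlonglongrightarrow> (1 - t) *\<^sub>R ?w t - (1 - s) *\<^sub>R ?w s + integral {s..t} ?w"
        by (simp only:) (intro tendsto_intros)
      have split: "integral {0..s} ?w + integral {s..t} ?w = integral {0..t} ?w"
        using st w by (intro Henstock_Kurzweil_Integration.integral_combine integrable_continuous_real) auto
      have "?B t \<omega> - ?B s \<omega> = (1 - t) *\<^sub>R ?w t - (1 - s) *\<^sub>R ?w s + integral {s..t} ?w"
        using st by (simp add: time_changed_noise_eq[where W = W and \<omega> = \<omega>, OF elim] flip: split)
      with lim show ?case
        by (simp only:)
    qed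
  qed unfold_locales
  show ?thesis
    unfolding wiener_process_def
  proof (intro conjI ballI impI)
    fix t :: real assume "t \<in> {0..<1}"
    then show "subalgebra M (F (t / (1 - t)))" "?B t \<in> borel_measurable (F (t / (1 - t)))"
      by (auto intro: sub B_adapted)
  next
    fix s t :: real assume "s \<in> {0..<1}" "t \<in> {0..<1}" "s \<le> t"
    then show "subalgebra (F (t / (1 - t))) (F (s / (1 - s)))"
      by (auto intro!: mono time_change_mono)
  next
    show "AE \<omega> in M. ?B 0 \<omega> = 0"
      using W0 by eventually_elim (simp add: time_changed_noise_def limI)
    show "AE \<omega> in M. continuous_on {0..<1} (\<lambda>\<tau>. ?B \<tau> \<omega>)"
      using cont
    proof eventually_elim
      case (elim \<omega>)
      have "continuous_on {0..<1} (\<lambda>\<tau>. (1 - \<tau>) *\<^sub>R W (\<tau> / (1 - \<tau>)) \<omega> +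
          integral {0..\<tau>} (\<lambda>s. W (s / (1 - s)) \<omega>))"
        by (intro continuous_intros continuous_on_indefinite_integral_Ico continuous_on_time_change elim)
      then show ?case
        by (rule continuous_on_cong[THEN iffD1, rotated 2]) (simp_all add: time_changed_noise_eq elim)
    qed
  next
    fix s t :: real assume "s \<in> {0..<1}" "t \<in> {0..<1}" "s < t"
    then have inc: "indep_gaussian M (F (s / (1 - s))) (\<lambda>\<omega>. ?B t \<omega> - ?B s \<omega>) (sqrt (t - s))"
      and pos: "0 < sqrt (t - s)"
      by (auto intro!: increment)
    show "distributed M lborel (\<lambda>\<omega>. ?B t \<omega> - ?B s \<omega>)
        (\<lambda>x. ennreal (\<Prod>b\<in>Basis. normal_density 0 (sqrt (t - s)) (x \<bullet> b)))"
      by (rule indep_gaussian_imp_distributed[OF prob_space_axioms inc pos])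
    show "indep_set (sets (F (s / (1 - s)))) (sets (vimage_algebra (space M) (\<lambda>\<omega>. ?B t \<omega> - ?B s \<omega>) borel))"
      by (rule indep_gaussian_imp_indep_set[OF prob_space_axioms inc])
  qed unfold_locales
qed

section \<open>The time-changed equation\<close>

text \<open>A statement about single paths. \<open>n\<close> is the old drift in the new clock, so
  its integral up to \<open>s\<close> is the time-changed \<open>x - w\<close>. Integrating
  \<open>(1 - u) n\<close> by parts produces the boundary value of \<open>x - w\<close> and the
  integral of \<open>x - w\<close>. The integral of \<open>x\<close> cancels against the term
  \<open>- x\<close> of the drift, and only the time-changed noise remains.\<close>

lemma polchinski_integral_equation:
  fixes x w m :: "real \<Rightarrow> 'v::euclidean_space"
  assumes x: "continuous_on {0..} x" and w: "continuous_on {0..} w"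
    and m: "\<And>t. 0 \<le> t \<Longrightarrow> set_integrable lborel {0..t} m"
    and eq: "\<And>t. 0 \<le> t \<Longrightarrow> x t = (LINT s:{0..t}|lborel. m s) + w t"
    and \<tau>: "0 \<le> \<tau>" "\<tau> < 1"
  defines "b \<equiv> \<lambda>s. (1 / (1 - s)) *\<^sub>R m (s / (1 - s)) - x (s / (1 - s))"
  shows "set_integrable lborel {0..\<tau>} b"
    and "(1 - \<tau>) *\<^sub>R x (\<tau> / (1 - \<tau>)) = (LINT s:{0..\<tau>}|lborel. b s) +
      ((1 - \<tau>) *\<^sub>R w (\<tau> / (1 - \<tau>)) + integral {0..\<tau>} (\<lambda>s. w (s / (1 - s))))"
proof -
  let ?x = "\<lambda>s. x (s / (1 - s))" and ?w = "\<lambda>s. w (s / (1 - s))"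
  define n where "n u = (1 / (1 - u)\<^sup>2) *\<^sub>R m (u / (1 - u))" for u
  have n_int: "set_integrable lborel {0..s} n"
    and n_eq: "(LINT u:{0..s}|lborel. n u) = ?x s - ?w s" if s: "0 \<le> s" "s \<le> \<tau>" for s
  proof -
    have deriv: "((\<lambda>u. u / (1 - u)) has_real_derivative 1 / (1 - u)\<^sup>2) (at u)" if "u \<in> {0..s}" for u
      using that s \<tau> by (auto intro!: derivative_eq_intros simp: power2_eq_square field_simps)
    have cont: "continuous_on {0..s} (\<lambda>u. 1 / (1 - u)\<^sup>2)"
      using s \<tau> by (auto intro!: continuous_intros)
    have m': "set_integrable lborel {0 / (1 - 0)..s / (1 - s)} m"
      using m[of "s / (1 - s)"] s \<tau> by simp
    note subst = set_integral_substitution[OF m' _ _ deriv cont]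
    show "set_integrable lborel {0..s} n"
      unfolding n_def[abs_def] by (rule subst(1)) (use s in auto)
    have "(LINT u:{0..s}|lborel. n u) = (LINT t:{0 / (1 - 0)..s / (1 - s)}|lborel. m t)"
      unfolding n_def by (rule subst(2)) (use s in auto)
    then show "(LINT u:{0..s}|lborel. n u) = ?x s - ?w s"
      using eq[of "s / (1 - s)"] s \<tau> by simp
  qed
  have x_int: "set_integrable lborel {0..\<tau>} ?x" and w_int: "set_integrable lborel {0..\<tau>} ?w"
    using \<tau>
    by (auto intro!: borel_integrable_atLeastAtMost' continuous_on_subset[OF continuous_on_time_change] x w)
  \<comment> \<open>The weights \<open>1 - u\<close> and \<open>\<tau> - u\<close> have absolute
    value at most 1 on \<open>{0..\<tau>}\<close>, so they preserve integrability.\<close>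
  have bounded_weight: "set_integrable lborel {0..\<tau>} (\<lambda>u. k u *\<^sub>R n u)"
    if [measurable]: "k \<in> borel_measurable borel" and k: "\<And>u. u \<in> {0..\<tau>} \<Longrightarrow> \<bar>k u\<bar> \<le> 1" for k
  proof -
    have int: "integrable lborel (\<lambda>u. indicator {0..\<tau>} u *\<^sub>R n u)"
      using n_int[of \<tau>] \<tau> by (simp add: set_integrable_def)
    have eq: "(\<lambda>u. indicator {0..\<tau>} u *\<^sub>R (k u *\<^sub>R n u)) = (\<lambda>u. k u *\<^sub>R (indicator {0..\<tau>} u *\<^sub>R n u))"
      by (rule ext) (rule scaleR_left_commute)
    show ?thesis
      unfolding set_integrable_def eq
    proof (rule Bochner_Integration.integrable_bound[OF int])
      show "(\<lambda>u. k u *\<^sub>R (indicator {0..\<tau>} u *\<^sub>R n u)) \<in> borel_measurable lborel"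
        by (rule borel_measurable_scaleR[OF _ borel_measurable_integrable[OF int]]) simp
      show "AE u in lborel. norm (k u *\<^sub>R (indicator {0..\<tau>} u *\<^sub>R n u)) \<le> norm (indicator {0..\<tau>} u *\<^sub>R n u)"
        using k by (intro AE_I2) (simp add: indicator_def mult_left_le_one_le)
    qed
  qed
  have w1: "set_integrable lborel {0..\<tau>} (\<lambda>u. (1 - u) *\<^sub>R n u)"
    and w2: "set_integrable lborel {0..\<tau>} (\<lambda>u. (\<tau> - u) *\<^sub>R n u)"
    using \<tau> bounded_weight[of "\<lambda>u. 1 - u"] bounded_weight[of "\<lambda>u. \<tau> - u"] by auto
  have b_eq: "b u = (1 - u) *\<^sub>R n u - ?x u" if "u \<in> {0..\<tau>}" for u
    using that \<tau> by (auto simp: b_def n_def power2_eq_square)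
  have "set_integrable lborel {0..\<tau>} (\<lambda>u. (1 - u) *\<^sub>R n u - ?x u)"
    by (rule set_integral_diff(1)[OF w1 x_int])
  then show "set_integrable lborel {0..\<tau>} b"
    by (rule set_integrable_cong[THEN iffD1, rotated 3]) (auto simp: b_eq)
  have "(LINT s:{0..\<tau>}|lborel. b s) = (LINT u:{0..\<tau>}|lborel. (1 - u) *\<^sub>R n u - ?x u)"
    by (rule set_lebesgue_integral_cong) (auto simp: b_eq)
  also have "\<dots> = (LINT u:{0..\<tau>}|lborel. (1 - u) *\<^sub>R n u) - (LINT u:{0..\<tau>}|lborel. ?x u)"
    by (rule set_integral_diff(2)[OF w1 x_int])
  \<comment> \<open>Writing \<open>1 - u = (1 - \<tau>) + (\<tau> - u)\<close> separates the
    boundary term from a weight of the form that the triangle identity turns into an iterated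
    integral.\<close>
  also have "(LINT u:{0..\<tau>}|lborel. (1 - u) *\<^sub>R n u) =
      (LINT u:{0..\<tau>}|lborel. (1 - \<tau>) *\<^sub>R n u + (\<tau> - u) *\<^sub>R n u)"
    by (rule set_lebesgue_integral_cong) (auto simp flip: scaleR_add_left)
  also have "\<dots> = (1 - \<tau>) *\<^sub>R (LINT u:{0..\<tau>}|lborel. n u) + (LINT u:{0..\<tau>}|lborel. (\<tau> - u) *\<^sub>R n u)"
    using n_int[of \<tau>] \<tau> w2 by (subst set_integral_add(2)) auto
  also have "(LINT u:{0..\<tau>}|lborel. (\<tau> - u) *\<^sub>R n u) = (LINT s:{0..\<tau>}|lborel. LINT u:{0..s}|lborel. n u)"
    using n_int[of \<tau>] \<tau> by (intro set_integral_set_integral_Icc[symmetric]) auto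
  also have "\<dots> = (LINT s:{0..\<tau>}|lborel. ?x s - ?w s)"
    by (rule set_lebesgue_integral_cong) (auto simp: n_eq)
  also have "\<dots> = (LINT s:{0..\<tau>}|lborel. ?x s) - (LINT s:{0..\<tau>}|lborel. ?w s)"
    by (rule set_integral_diff(2)[OF x_int w_int])
  finally show "(1 - \<tau>) *\<^sub>R x (\<tau> / (1 - \<tau>)) = (LINT s:{0..\<tau>}|lborel. b s) +
      ((1 - \<tau>) *\<^sub>R w (\<tau> / (1 - \<tau>)) + integral {0..\<tau>} (\<lambda>s. w (s / (1 - s))))"
    using \<tau> n_eq[of \<tau>] set_borel_integral_eq_integral(2)[OF w_int] by (simp add: algebra_simps)
qed

text \<open>The two exponents are the same function of the space variable, so the normalising
  constants agree as well. The identity is deterministic and holds for every state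
  \<open>u\<close>.\<close>

lemma tilt_measure_time_change:
  assumes "0 \<le> \<tau>" "\<tau> < 1"
  shows "tilt_measure \<pi>0 (\<tau> / (1 - \<tau>)) ((1 / (1 - \<tau>)) *\<^sub>R u) = fluctuation_measure \<pi>0 \<tau> u"
  using assms by (simp add: tilt_measure_def fluctuation_measure_def mult.commute)

lemma polchinski_drift_time_change:
  assumes "0 \<le> \<tau>" "\<tau> < 1"
  shows "polchinski_drift \<pi>0 \<tau> ((1 - \<tau>) *\<^sub>R y) =
    (1 / (1 - \<tau>)) *\<^sub>R localization_drift \<pi>0 (\<tau> / (1 - \<tau>)) y - y"
  using assms tilt_measure_time_change[OF assms, of \<pi>0 "(1 - \<tau>) *\<^sub>R y"]
  by (simp add: polchinski_drift_def localization_drift_def scaleR_diff_right)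

lemma polchinski_solution_of_localization:
  assumes sol: "sde_solution {0..} (localization_drift \<pi>0) M F W c"
  shows "sde_solution {0..<1} (polchinski_drift \<pi>0) M (\<lambda>\<tau>. F (\<tau> / (1 - \<tau>)))
    (time_changed_noise W) (\<lambda>\<tau> \<omega>. (1 - \<tau>) *\<^sub>R c (\<tau> / (1 - \<tau>)) \<omega>)"
  unfolding sde_solution_def
proof (intro conjI ballI)
  have W: "wiener_process {0..} M F W"
    and c: "\<And>t. 0 \<le> t \<Longrightarrow> c t \<in> borel_measurable (F t)"
    and cont: "AE \<omega> in M. continuous_on {0..} (\<lambda>t. c t \<omega>)"
    and c0: "AE \<omega> in M. c 0 \<omega> = 0"
    and eq: "AE \<omega> in M. \<forall>t\<in>{0..}.
        set_integrable lborel {0..t} (\<lambda>s. localization_drift \<pi>0 s (c s \<omega>)) \<and>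
        c t \<omega> = c 0 \<omega> + (LINT s:{0..t}|lborel. localization_drift \<pi>0 s (c s \<omega>)) + W t \<omega>"
    using sol by (auto simp: sde_solution_def)
  have W_cont: "AE \<omega> in M. continuous_on {0..} (\<lambda>t. W t \<omega>)"
    using W by (simp add: wiener_process_def)
  show "wiener_process {0..<1} M (\<lambda>\<tau>. F (\<tau> / (1 - \<tau>))) (time_changed_noise W)"
    by (rule wiener_process_time_changed_noise[OF W])
  show "(\<lambda>\<omega>. (1 - \<tau>) *\<^sub>R c (\<tau> / (1 - \<tau>)) \<omega>) \<in> borel_measurable (F (\<tau> / (1 - \<tau>)))"
    if "\<tau> \<in> {0..<1}" for \<tau>
    using that by (intro borel_measurable_scaleR c) auto
  show "AE \<omega> in M. continuous_on {0..<1} (\<lambda>\<tau>. (1 - \<tau>) *\<^sub>R c (\<tau> / (1 - \<tau>)) \<omega>)"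
    using cont by eventually_elim (intro continuous_intros continuous_on_time_change)
  show "AE \<omega> in M. (1 - 0) *\<^sub>R c (0 / (1 - 0)) \<omega> = 0"
    using c0 by simp
  show "AE \<omega> in M. \<forall>\<tau>\<in>{0..<1}.
      set_integrable lborel {0..\<tau>} (\<lambda>s. polchinski_drift \<pi>0 s ((1 - s) *\<^sub>R c (s / (1 - s)) \<omega>)) \<and>
      (1 - \<tau>) *\<^sub>R c (\<tau> / (1 - \<tau>)) \<omega> = (1 - 0) *\<^sub>R c (0 / (1 - 0)) \<omega> +
        (LINT s:{0..\<tau>}|lborel. polchinski_drift \<pi>0 s ((1 - s) *\<^sub>R c (s / (1 - s)) \<omega>)) +
        time_changed_noise W \<tau> \<omega>"
    \<comment> \<open>The exceptional null set comes from these four properties of whole paths and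
      does not depend on \<open>\<tau>\<close>, so one null set serves all the uncountably many
      times.\<close>
    using cont c0 eq W_cont
  proof eventually_elim
    case (elim \<omega>)
    show ?case
    proof
      fix \<tau> :: real assume \<tau>: "\<tau> \<in> {0..<1}"
      let ?m = "\<lambda>s. localization_drift \<pi>0 s (c s \<omega>)"
      let ?b = "\<lambda>s. (1 / (1 - s)) *\<^sub>R ?m (s / (1 - s)) - c (s / (1 - s)) \<omega>"
      let ?b' = "\<lambda>s. polchinski_drift \<pi>0 s ((1 - s) *\<^sub>R c (s / (1 - s)) \<omega>)"
      have b: "?b' s = ?b s" if "s \<in> {0..\<tau>}" for s
        using that \<tau> by (intro polchinski_drift_time_change) auto
      have m: "set_integrable lborel {0..t} ?m"
        and c_eq: "c t \<omega> = (LINT s:{0..t}|lborel. ?m s) + W t \<omega>" if "0 \<le> t" for t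
      proof -
        have "set_integrable lborel {0..t} ?m \<and>
            c t \<omega> = c 0 \<omega> + (LINT s:{0..t}|lborel. ?m s) + W t \<omega>"
          using elim(3) that by blast
        then show "set_integrable lborel {0..t} ?m" "c t \<omega> = (LINT s:{0..t}|lborel. ?m s) + W t \<omega>"
          by (simp_all only: elim(2) add_0_left)
      qed
      have "0 \<le> \<tau>" "\<tau> < 1" using \<tau> by auto
      note polchinski_integral_equation[where x = "\<lambda>t. c t \<omega>" and w = "\<lambda>t. W t \<omega>" and m = ?m,
          OF elim(1,4) m c_eq this]
      moreover have "set_integrable lborel {0..\<tau>} ?b' = set_integrable lborel {0..\<tau>} ?b"
        by (rule set_integrable_cong) (auto simp: b)
      moreover have "(LINT s:{0..\<tau>}|lborel. ?b' s) = (LINT s:{0..\<tau>}|lborel. ?b s)"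
        by (rule set_lebesgue_integral_cong) (auto simp: b)
      ultimately show "set_integrable lborel {0..\<tau>} ?b' \<and>
          (1 - \<tau>) *\<^sub>R c (\<tau> / (1 - \<tau>)) \<omega> = (1 - 0) *\<^sub>R c (0 / (1 - 0)) \<omega> +
            (LINT s:{0..\<tau>}|lborel. ?b' s) + time_changed_noise W \<tau> \<omega>"
        using elim(2,4) \<tau> by (simp add: time_changed_noise_eq)
    qed
  qed
qed

section \<open>Induced measures as measurable functions of the state, and laws of images of
  processes\<close>

lemma subprob_space_normalized:
  assumes [measurable]: "g \<in> borel_measurable borel"
  shows "subprob_space (normalized g)"
proof
  let ?Z = "\<integral>\<^sup>+y. ennreal (g y) \<partial>lborel"
  have "emeasure (normalized g) (space (normalized g)) = ?Z / ?Z"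
    by (simp add: normalized_def emeasure_density nn_integral_divide)
  \<comment> \<open>The total mass is 1 for a positive finite constant; when the constant is 0 or
    \<open>\<infinity>\<close>, the quotient is 0 by the conventions of \<open>ennreal\<close>. This
    is why the measures live in \<open>subprob_algebra\<close>.\<close>
  also have "\<dots> \<le> 1"
    by (cases "?Z = 0"; cases "?Z = \<infinity>") (auto simp: ennreal_divide_self less_top)
  finally show "emeasure (normalized g) (space (normalized g)) \<le> 1" .
  show "space (normalized g) \<noteq> {}"
    by (simp add: normalized_def)
qed

text \<open>Makes the induced measure a random variable: the mass of a fixed set is a quotient of
  integrals that depend measurably on the parameter \<open>c\<close>.\<close>

lemma measurable_tilt_measure:
  assumes [measurable]: "\<pi>0 \<in> borel_measurable borel"
  shows "tilt_measure \<pi>0 t \<in> borel \<rightarrow>\<^sub>M subprob_algebra borel"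
proof (rule measurable_subprob_algebra)
  fix A :: "'a set" assume [measurable]: "A \<in> sets borel"
  show "(\<lambda>c. emeasure (tilt_measure \<pi>0 t c) A) \<in> borel_measurable borel"
    by (simp add: tilt_measure_def normalized_def emeasure_density)
qed (simp_all add: tilt_measure_def subprob_space_normalized, simp add: normalized_def)

lemma process_law_image:
  assumes X: "\<And>t. t \<in> I \<Longrightarrow> X t \<in> M \<rightarrow>\<^sub>M S" and f: "\<And>t. t \<in> I \<Longrightarrow> f t \<in> S \<rightarrow>\<^sub>M K"
  shows "process_law I M K (\<lambda>t \<omega>. f t (X t \<omega>)) =
    distr (process_law I M S X) (\<Pi>\<^sub>M t\<in>I. K) (\<lambda>x. \<lambda>t\<in>I. f t (x t))"
proof -
  have "(\<lambda>\<omega>. \<lambda>t\<in>I. X t \<omega>) \<in> M \<rightarrow>\<^sub>M (\<Pi>\<^sub>M t\<in>I. S)"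
    using X by (intro measurable_restrict)
  moreover have "(\<lambda>x. \<lambda>t\<in>I. f t (x t)) \<in> (\<Pi>\<^sub>M t\<in>I. S) \<rightarrow>\<^sub>M (\<Pi>\<^sub>M t\<in>I. K)"
  proof (rule measurable_restrict)
    fix t assume t: "t \<in> I"
    show "(\<lambda>x. f t (x t)) \<in> (\<Pi>\<^sub>M t\<in>I. S) \<rightarrow>\<^sub>M K"
      by (rule measurable_compose[where g = "f t", OF measurable_component_singleton[OF t] f[OF t]])
  qed
  ultimately show ?thesis
    unfolding process_law_def by (simp add: distr_distr comp_def cong: restrict_cong)
qed

lemma process_law_cong:
  assumes "\<And>t \<omega>. t \<in> I \<Longrightarrow> X t \<omega> = Y t \<omega>"
  shows "process_law I M S X = process_law I M S Y"
  using assms by (simp add: process_law_def cong: restrict_cong)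

lemma sde_solution_measurable:
  assumes sol: "sde_solution I b M F W X" and t: "t \<in> I"
  shows "X t \<in> borel_measurable M"
proof (rule measurable_from_subalg)
  show "subalgebra M (F t)" "X t \<in> borel_measurable (F t)"
    using sol t by (simp_all add: sde_solution_def wiener_process_def)
qed

theorem theorem4:
  fixes \<pi>0 :: "'v::euclidean_space \<Rightarrow> real"
    and M :: "'a measure" and F :: "real \<Rightarrow> 'a measure" and W c :: "real \<Rightarrow> 'a \<Rightarrow> 'v"
    and N :: "'b measure" and G :: "real \<Rightarrow> 'b measure" and B v :: "real \<Rightarrow> 'b \<Rightarrow> 'v"
  assumes density_measurable: "\<pi>0 \<in> borel_measurable borel"
    and density_nonneg: "\<And>x. 0 \<le> \<pi>0 x"
    and density_prob: "prob_space (density lborel (\<lambda>x. ennreal (\<pi>0 x)))"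
    and finite_mean: "integrable (density lborel (\<lambda>x. ennreal (\<pi>0 x))) (\<lambda>x. x)"
    and well_posed_localization: "well_posed {0..} (localization_drift \<pi>0)"
    and well_posed_polchinski: "well_posed {0..<1} (polchinski_drift \<pi>0)"
    and localization: "sde_solution {0..} (localization_drift \<pi>0) M F W c"
    and polchinski: "sde_solution {0..<1} (polchinski_drift \<pi>0) N G B v"
  shows "process_law {0..<1} M borel (\<lambda>\<tau>. c (\<tau> / (1 - \<tau>))) =
           process_law {0..<1} N borel (\<lambda>\<tau> \<omega>. (1 / (1 - \<tau>)) *\<^sub>R v \<tau> \<omega>)
       \<and> (\<forall>\<tau>\<in>{0..<1}. \<forall>u.
           tilt_measure \<pi>0 (\<tau> / (1 - \<tau>)) ((1 / (1 - \<tau>)) *\<^sub>R u) = fluctuation_measure \<pi>0 \<tau> u)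
       \<and> process_law {0..<1} M (borel \<Otimes>\<^sub>M subprob_algebra borel)
           (\<lambda>\<tau> \<omega>. (c (\<tau> / (1 - \<tau>)) \<omega>, tilt_measure \<pi>0 (\<tau> / (1 - \<tau>)) (c (\<tau> / (1 - \<tau>)) \<omega>))) =
         process_law {0..<1} N (borel \<Otimes>\<^sub>M subprob_algebra borel)
           (\<lambda>\<tau> \<omega>. ((1 / (1 - \<tau>)) *\<^sub>R v \<tau> \<omega>, fluctuation_measure \<pi>0 \<tau> (v \<tau> \<omega>)))"
proof -
  let ?I = "{0..<1} :: real set"
  let ?c = "\<lambda>\<tau> \<omega>. (1 - \<tau>) *\<^sub>R c (\<tau> / (1 - \<tau>)) \<omega>"
  note sol = polchinski_solution_of_localization[OF localization]
  have law: "process_law ?I M borel ?c = process_law ?I N borel v"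
    by (rule well_posed_process_law_eq[OF well_posed_polchinski sol polchinski])
  \<comment> \<open>A family of measurable maps, one for each time, carries the equality of laws
    over to the image processes. It is used for the rescaling and again for the pairs of state and
    measure.\<close>
  have law_image: "process_law ?I M K (\<lambda>\<tau> \<omega>. f \<tau> (?c \<tau> \<omega>)) = process_law ?I N K (\<lambda>\<tau> \<omega>. f \<tau> (v \<tau> \<omega>))"
    if f: "\<And>\<tau>. \<tau> \<in> ?I \<Longrightarrow> f \<tau> \<in> borel \<rightarrow>\<^sub>M K" for f and K :: "'k measure"
  proof -
    have "process_law ?I M K (\<lambda>\<tau> \<omega>. f \<tau> (?c \<tau> \<omega>)) =
        distr (process_law ?I M borel ?c) (\<Pi>\<^sub>M \<tau>\<in>?I. K) (\<lambda>x. \<lambda>\<tau>\<in>?I. f \<tau> (x \<tau>))"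
      by (rule process_law_image[where X = ?c, OF sde_solution_measurable[OF sol] f])
    also have "\<dots> = process_law ?I N K (\<lambda>\<tau> \<omega>. f \<tau> (v \<tau> \<omega>))"
      unfolding law
      by (rule process_law_image[where X = v, OF sde_solution_measurable[OF polchinski] f, symmetric])
    finally show ?thesis .
  qed
  have processes: "process_law ?I M borel (\<lambda>\<tau>. c (\<tau> / (1 - \<tau>))) =
      process_law ?I N borel (\<lambda>\<tau> \<omega>. (1 / (1 - \<tau>)) *\<^sub>R v \<tau> \<omega>)"
  proof -
    have "process_law ?I M borel (\<lambda>\<tau>. c (\<tau> / (1 - \<tau>))) =
        process_law ?I M borel (\<lambda>\<tau> \<omega>. (1 / (1 - \<tau>)) *\<^sub>R ?c \<tau> \<omega>)"
      by (rule process_law_cong) simp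
    also have "\<dots> = process_law ?I N borel (\<lambda>\<tau> \<omega>. (1 / (1 - \<tau>)) *\<^sub>R v \<tau> \<omega>)"
      by (rule law_image) simp
    finally show ?thesis .
  qed
  have measures: "tilt_measure \<pi>0 (\<tau> / (1 - \<tau>)) ((1 / (1 - \<tau>)) *\<^sub>R u) = fluctuation_measure \<pi>0 \<tau> u"
    if "\<tau> \<in> ?I" for \<tau> u
    using that by (intro tilt_measure_time_change) auto
  have induced: "process_law ?I M (borel \<Otimes>\<^sub>M subprob_algebra borel)
      (\<lambda>\<tau> \<omega>. (c (\<tau> / (1 - \<tau>)) \<omega>, tilt_measure \<pi>0 (\<tau> / (1 - \<tau>)) (c (\<tau> / (1 - \<tau>)) \<omega>))) =
    process_law ?I N (borel \<Otimes>\<^sub>M subprob_algebra borel)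
      (\<lambda>\<tau> \<omega>. ((1 / (1 - \<tau>)) *\<^sub>R v \<tau> \<omega>, fluctuation_measure \<pi>0 \<tau> (v \<tau> \<omega>)))" (is "?L = ?R")
  proof -
    \<comment> \<open>State and measure are both computed from the same \<open>y\<close>, which
      yields the joint law of the two and not merely the two separate laws.\<close>
    let ?f = "\<lambda>\<tau> y. ((1 / (1 - \<tau>)) *\<^sub>R y, tilt_measure \<pi>0 (\<tau> / (1 - \<tau>)) ((1 / (1 - \<tau>)) *\<^sub>R y))"
    have "?L = process_law ?I M (borel \<Otimes>\<^sub>M subprob_algebra borel) (\<lambda>\<tau> \<omega>. ?f \<tau> (?c \<tau> \<omega>))"
      by (rule process_law_cong) simp
    also have "\<dots> = process_law ?I N (borel \<Otimes>\<^sub>M subprob_algebra borel) (\<lambda>\<tau> \<omega>. ?f \<tau> (v \<tau> \<omega>))"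
      by (rule law_image)
         (intro measurable_Pair measurable_compose[OF _ measurable_tilt_measure[OF density_measurable]],
           simp_all)
    also have "\<dots> = ?R"
      by (rule process_law_cong) (simp add: measures)
    finally show ?thesis .
  qed
  show ?thesis
    using processes measures induced by blast
qed

end
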